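(* Let $\mathcal{X}$ be a metric space with its Borel $\sigma$-algebra, let $(\mathcal{X},\mathcal{A},L)$ be a basic game and let $\Gamma\subseteq\mathcal{P}$ be nonempty. Suppose the following conditions hold. (1) Whenever $(Q_n)$ is a sequence of distributions in $\Gamma$, with respective Bayes acts $(\zeta_n)$, such that the sequence $(H(Q_n))$ is bounded below and $(Q_n)$ converges weakly to some distribution $Q_0\in\mathcal{P}_0$, then $Q_0\in\mathcal{P}$, $Q_0$ has a Bayes act $\zeta_0$ and, for some choice of the Bayes acts $(\zeta_n)$ and $\zeta_0$, $L(P,\zeta_0)\le\liminf_{n\to\infty}L(P,\zeta_n)$ for all $P\in\Gamma$. (2) $\Gamma$ is convex; every $P\in\Gamma$ has a Bayes act $\zeta_P$ and finite entropy $H(P)$; and $H^*:=\sup_{P\in\Gamma}H(P)<\infty$. (3) $\Gamma$ is tight. Then there exists $\zeta^*\in\mathcal{Z}$ such that $$\sup_{P\in\Gamma}L(P,\zeta^* )=\inf_{\zeta\in\mathcal{Z}}\sup_{P\in\Gamma}L(P,\zeta)=\sup_{P\in\Gamma}\inf_{a\in\mathcal{A}}L(P,a)=H^*.$$ In particular, the game $\mathcal{G}^\Gamma=(\Gamma,\mathcal{A},L)$ has value $H^*$, and $\zeta^*$ is robust Bayes against $\Gamma$.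
   Context: A basic game $(\mathcal{X},\mathcal{A},L)$ consists of measurable spaces $\mathcal{X}$ and $\mathcal{A}$ (with $\sigma$-fields containing all singletons) and a jointly measurable loss function $L:\mathcal{X}\times\mathcal{A}\to(-\infty,\infty]$. $\mathcal{P}_0$ is the set of all probability distributions on $\mathcal{X}$. Expectations are taken in the extended sense $E f=E f^+-E f^-$, defined unless both terms are infinite. $L(P,a):=E_P\{L(X,a)\}$, and $\mathcal{P}$ is the set of all $P\in\mathcal{P}_0$ such that $L(P,a)$ is defined for all $a\in\mathcal{A}$. For a randomized act $\zeta$ (a probability distribution on $\mathcal{A}$), $L(x,\zeta):=E_{A\sim\zeta}\{L(x,A)\}$ and $L(P,\zeta):=E_{(X,A)\sim P\times\zeta}\{L(X,A)\}$; $\mathcal{Z}$ is the set of all $\zeta$ such that $L(P,\zeta)$ is defined for all $P\in\mathcal{P}$. An act $\zeta_P\in\mathcal{Z}$ is Bayes against $P$ (a Bayes act of $P$) if $E_P\{L(X,\zeta)-L(X,\zeta_P)\}\in[0,\infty]$ for all $\zeta\in\mathcal{Z}$. The generalized entropy is $H(P):=\inf_{a\in\mathcal{A}}L(P,a)$. The game $\mathcal{G}^\Gamma$ has value $V$ if $V=\sup_{P\in\Gamma}\inf_{\zeta\in\mathcal{Z}}L(P,\zeta)=\inf_{\zeta\in\mathcal{Z}}\sup_{P\in\Gamma}L(P,\zeta)$ is finite. An act is robust Bayes against $\Gamma$ if it attains $\inf_{\zeta\in\mathcal{Z}}\sup_{P\in\Gamma}L(P,\zeta)$. $\Gamma$ is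 tight if for all $\varepsilon>0$ there is a compact set $C\subseteq\mathcal{X}$ with $P(C)>1-\varepsilon$ for all $P\in\Gamma$.
   Formalization: In condition (1) the Bayes act ζ₀ is chosen once for each limit Q₀, not separately for each sequence (Q_n). With ζ₀ depending on the sequence the claim fails: purely atomic laws on [0,1], acts sequences in [0,1], loss 0 if x occurs in the sequence and 1 otherwise. *)

theory Defs
  imports "HOL-Probability.Probability"
begin

text \<open>
  Expectations in the extended sense. The library's Bochner integral is neither extended-real valued
  nor does it distinguish an undefined expectation, so positive and negative parts are integrated
  separately. Since \<open>\<infinity> - \<infinity> = \<infinity>\<close> on \<^typ>\<open>ereal\<close>, the value of \<open>ext_expect\<close> is only meaningful
  together with \<open>ext_expect_defined\<close>.
\<close>

definition pos_part_int :: "'b measure \<Rightarrow> ('b \<Rightarrow> ereal) \<Rightarrow> ennreal" where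
  "pos_part_int M f = (\<integral>\<^sup>+ x. e2ennreal (max 0 (f x)) \<partial>M)"

definition ext_expect_defined :: "'b measure \<Rightarrow> ('b \<Rightarrow> ereal) \<Rightarrow> bool" where
  "ext_expect_defined M f \<longleftrightarrow> \<not> (pos_part_int M f = \<infinity> \<and> pos_part_int M (\<lambda>x. - f x) = \<infinity>)"

definition ext_expect :: "'b measure \<Rightarrow> ('b \<Rightarrow> ereal) \<Rightarrow> ereal" where
  "ext_expect M f = enn2ereal (pos_part_int M f) - enn2ereal (pos_part_int M (\<lambda>x. - f x))"

text \<open>
  Measurable spaces are represented, as usual in the library, by measures of which only the carrier
  and the \<open>\<sigma>\<close>-algebra matter.
\<close>

definition distributions :: "'b measure \<Rightarrow> 'b measure set" where
  "distributions M = {P. prob_space P \<and> sets P = sets M}"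

definition basic_game :: "'x measure \<Rightarrow> 'a measure \<Rightarrow> ('x \<Rightarrow> 'a \<Rightarrow> ereal) \<Rightarrow> bool" where
  "basic_game X A L \<longleftrightarrow>
     (\<forall>x\<in>space X. {x} \<in> sets X) \<and>
     (\<forall>a\<in>space A. {a} \<in> sets A) \<and>
     (\<lambda>(x, a). L x a) \<in> borel_measurable (X \<Otimes>\<^sub>M A) \<and>
     (\<forall>x\<in>space X. \<forall>a\<in>space A. L x a \<noteq> - \<infinity>)"

definition exp_loss :: "('x \<Rightarrow> 'a \<Rightarrow> ereal) \<Rightarrow> 'x measure \<Rightarrow> 'a \<Rightarrow> ereal" where
  "exp_loss L P a = ext_expect P (\<lambda>x. L x a)"

definition game_dists :: "'x measure \<Rightarrow> 'a measure \<Rightarrow> ('x \<Rightarrow> 'a \<Rightarrow> ereal) \<Rightarrow> 'x measure set" where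
  "game_dists X A L =
     {P \<in> distributions X. \<forall>a\<in>space A. ext_expect_defined P (\<lambda>x. L x a)}"

definition rand_loss :: "('x \<Rightarrow> 'a \<Rightarrow> ereal) \<Rightarrow> 'x \<Rightarrow> 'a measure \<Rightarrow> ereal" where
  "rand_loss L x \<zeta> = ext_expect \<zeta> (\<lambda>a. L x a)"

definition rand_exp_loss :: "('x \<Rightarrow> 'a \<Rightarrow> ereal) \<Rightarrow> 'x measure \<Rightarrow> 'a measure \<Rightarrow> ereal" where
  "rand_exp_loss L P \<zeta> = ext_expect (P \<Otimes>\<^sub>M \<zeta>) (\<lambda>(x, a). L x a)"

definition rand_acts :: "'x measure \<Rightarrow> 'a measure \<Rightarrow> ('x \<Rightarrow> 'a \<Rightarrow> ereal) \<Rightarrow> 'a measure set" where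
  "rand_acts X A L =
     {\<zeta> \<in> distributions A. \<forall>P\<in>game_dists X A L. ext_expect_defined (P \<Otimes>\<^sub>M \<zeta>) (\<lambda>(x, a). L x a)}"

text \<open>
  That \<open>E\<^sub>P{L(X,\<zeta>) - L(X,\<zeta>\<^sub>P)}\<close> lies in \<open>[0,\<infinity>]\<close> includes that it is defined; in particular
  the difference must be of the form \<open>\<infinity> - \<infinity>\<close> or \<open>-\<infinity> + \<infinity>\<close> only on a null set. For \<open>\<zeta>\<close> in
  \<^const>\<open>rand_acts\<close> the loss \<open>L(x,\<zeta>)\<close> itself is always defined, because the point mass at \<open>x\<close> is in
  \<^const>\<open>game_dists\<close>.
\<close>

definition bayes_act ::
  "'x measure \<Rightarrow> 'a measure \<Rightarrow> ('x \<Rightarrow> 'a \<Rightarrow> ereal) \<Rightarrow> 'x measure \<Rightarrow> 'a measure \<Rightarrow> bool" where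
  "bayes_act X A L P \<zeta>P \<longleftrightarrow>
     \<zeta>P \<in> rand_acts X A L \<and>
     (\<forall>\<zeta>\<in>rand_acts X A L.
        (AE x in P. \<not> (rand_loss L x \<zeta> = rand_loss L x \<zeta>P \<and> \<bar>rand_loss L x \<zeta>\<bar> = \<infinity>)) \<and>
        ext_expect_defined P (\<lambda>x. rand_loss L x \<zeta> - rand_loss L x \<zeta>P) \<and>
        0 \<le> ext_expect P (\<lambda>x. rand_loss L x \<zeta> - rand_loss L x \<zeta>P))"

definition gen_entropy :: "'a measure \<Rightarrow> ('x \<Rightarrow> 'a \<Rightarrow> ereal) \<Rightarrow> 'x measure \<Rightarrow> ereal" where
  "gen_entropy A L P = (INF a\<in>space A. exp_loss L P a)"

definition max_entropy :: "'a measure \<Rightarrow> ('x \<Rightarrow> 'a \<Rightarrow> ereal) \<Rightarrow> 'x measure set \<Rightarrow> ereal" where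
  "max_entropy A L \<Gamma> = (SUP P\<in>\<Gamma>. gen_entropy A L P)"

definition upper_value ::
  "'x measure \<Rightarrow> 'a measure \<Rightarrow> ('x \<Rightarrow> 'a \<Rightarrow> ereal) \<Rightarrow> 'x measure set \<Rightarrow> ereal" where
  "upper_value X A L \<Gamma> = (INF \<zeta>\<in>rand_acts X A L. SUP P\<in>\<Gamma>. rand_exp_loss L P \<zeta>)"

definition lower_value ::
  "'x measure \<Rightarrow> 'a measure \<Rightarrow> ('x \<Rightarrow> 'a \<Rightarrow> ereal) \<Rightarrow> 'x measure set \<Rightarrow> ereal" where
  "lower_value X A L \<Gamma> = (SUP P\<in>\<Gamma>. INF \<zeta>\<in>rand_acts X A L. rand_exp_loss L P \<zeta>)"

definition game_has_value ::
  "'x measure \<Rightarrow> 'a measure \<Rightarrow> ('x \<Rightarrow> 'a \<Rightarrow> ereal) \<Rightarrow> 'x measure set \<Rightarrow> ereal \<Rightarrow> bool" where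
  "game_has_value X A L \<Gamma> V \<longleftrightarrow>
     V = lower_value X A L \<Gamma> \<and> V = upper_value X A L \<Gamma> \<and> \<bar>V\<bar> \<noteq> \<infinity>"

definition robust_bayes ::
  "'x measure \<Rightarrow> 'a measure \<Rightarrow> ('x \<Rightarrow> 'a \<Rightarrow> ereal) \<Rightarrow> 'x measure set \<Rightarrow> 'a measure \<Rightarrow> bool" where
  "robust_bayes X A L \<Gamma> \<zeta> \<longleftrightarrow>
     \<zeta> \<in> rand_acts X A L \<and> (SUP P\<in>\<Gamma>. rand_exp_loss L P \<zeta>) = upper_value X A L \<Gamma>"

text \<open>A mixture is determined by its values, so it is described rather than constructed.\<close>

definition convex_dists :: "'x measure set \<Rightarrow> bool" where
  "convex_dists \<Gamma> \<longleftrightarrow>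
     (\<forall>P\<in>\<Gamma>. \<forall>Q\<in>\<Gamma>. \<forall>t\<in>{0..1::real}. \<exists>R\<in>\<Gamma>.
        \<forall>B\<in>sets P. measure R B = (1 - t) * measure P B + t * measure Q B)"

text \<open>
  The library's \<open>weak_conv_m\<close> and \<open>tight\<close> concern measures on the real line (the latter,
  sequences of them) only.
\<close>

definition converges_weakly :: "(nat \<Rightarrow> 'x::metric_space measure) \<Rightarrow> 'x measure \<Rightarrow> bool" where
  "converges_weakly Q Q0 \<longleftrightarrow>
     (\<forall>f::'x \<Rightarrow> real. continuous_on UNIV f \<and> bounded (range f) \<longrightarrow>
        (\<lambda>n. integral\<^sup>L (Q n) f) \<longlonglongrightarrow> integral\<^sup>L Q0 f)"

definition tight_dists :: "'x::metric_space measure set \<Rightarrow> bool" where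
  "tight_dists \<Gamma> \<longleftrightarrow>
     (\<forall>\<epsilon>>0. \<exists>C. compact C \<and> (\<forall>P\<in>\<Gamma>. measure P C > 1 - \<epsilon>))"

text \<open>
  The Bayes act \<open>\<beta> Q0\<close> of a limit \<open>Q0\<close> (the act \<open>\<zeta>\<^sub>0\<close>) is chosen for the distribution \<open>Q0\<close>, not
  separately for each sequence converging to it, whereas the acts \<open>\<zeta>\<close> of the members are chosen for
  each sequence. If \<open>\<beta> Q0\<close> could vary with the sequence, the minimax theorem would fail: take
  the purely atomic distributions on \<open>[0,1]\<close>, sequences in \<open>[0,1]\<close> as acts, and the loss that is \<open>0\<close>
  if \<open>x\<close> is a member of the sequence and \<open>1\<close> otherwise.
\<close>

definition bayes_limit_condition ::
  "'x::metric_space measure \<Rightarrow> 'a measure \<Rightarrow> ('x \<Rightarrow> 'a \<Rightarrow> ereal) \<Rightarrow> 'x measure set \<Rightarrow> bool" where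
  "bayes_limit_condition X A L \<Gamma> \<longleftrightarrow>
     (\<exists>\<beta>. \<forall>Q Q0.
        (\<forall>n::nat. Q n \<in> \<Gamma> \<and> (\<exists>\<zeta>. bayes_act X A L (Q n) \<zeta>)) \<and>
        (\<exists>b::real. \<forall>n. ereal b \<le> gen_entropy A L (Q n)) \<and>
        Q0 \<in> distributions X \<and> converges_weakly Q Q0 \<longrightarrow>
          Q0 \<in> game_dists X A L \<and>
          bayes_act X A L Q0 (\<beta> Q0) \<and>
          (\<exists>\<zeta>. (\<forall>n. bayes_act X A L (Q n) (\<zeta> n)) \<and>
               (\<forall>P\<in>\<Gamma>. rand_exp_loss L P (\<beta> Q0) \<le> liminf (\<lambda>n. rand_exp_loss L P (\<zeta> n)))))"

end

theory Submission
  imports Defs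
begin

text \<open>
  Choose \<open>Q\<^sub>n\<close> in \<open>\<Gamma>\<close> with \<open>H(Q\<^sub>n) \<ge> H\<^sup>* - t\<^sub>n\<^sup>2\<close>, where \<open>t\<^sub>n \<rightarrow> 0\<close>, and pass to a subsequence
  converging weakly to some \<open>Q\<^sub>0\<close>. For \<open>P\<close> in \<open>\<Gamma>\<close> the mixtures \<open>R\<^sub>n = (1 - t\<^sub>n) Q\<^sub>n + t\<^sub>n P\<close>
  have the same limit. If \<open>\<zeta>\<^sub>n\<close> is Bayes against \<open>R\<^sub>n\<close>, then
  \<open>H\<^sup>* \<ge> L(R\<^sub>n, \<zeta>\<^sub>n) \<ge> (1 - t\<^sub>n) H(Q\<^sub>n) + t\<^sub>n L(P, \<zeta>\<^sub>n)\<close>, so \<open>L(P, \<zeta>\<^sub>n) \<le> H\<^sup>* + t\<^sub>n\<close>, and in the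
  limit \<open>L(P, \<zeta>\<^sub>0) \<le> H\<^sup>*\<close>, where the Bayes act \<open>\<zeta>\<^sub>0\<close> of \<open>Q\<^sub>0\<close> does not depend on \<open>P\<close>.

  The subsequence comes from Prokhorov's theorem, which is reduced to Helly's selection theorem on the
  real line: a \<open>\<sigma>\<close>-compact set has a Borel injection into the reals whose inverse is continuous and
  extends continuously to the closure of the range.
\<close>

section \<open>Prokhorov's theorem\<close>

text \<open>The digits are 0 and 1 but the base is 3. All places after \<open>k\<close> together
  weigh \<open>(1/3)^k / 2\<close>, half of place \<open>k\<close>, so carries cannot make different
  digit sequences share a code, as they can in base 2.\<close>

definition ternary_code :: "(nat \<Rightarrow> 'x set) \<Rightarrow> 'x \<Rightarrow> real" where
  "ternary_code B x = (\<Sum>i. indicator (B i) x * (1 / 3) ^ i)"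

lemma summable_ternary_code: "summable (\<lambda>i. indicator (B i) x * (1 / 3 :: real) ^ i)"
  by (rule summable_comparison_test'[where g = "\<lambda>i. (1 / 3) ^ i" and N = 0])
    (auto simp: indicator_def)

lemma ternary_code_bounds: "0 \<le> ternary_code B x" "ternary_code B x \<le> 3 / 2"
proof -
  show "0 \<le> ternary_code B x"
    unfolding ternary_code_def by (intro suminf_nonneg summable_ternary_code) auto
  have "ternary_code B x \<le> (\<Sum>i. (1 / 3) ^ i)"
    unfolding ternary_code_def
    by (intro suminf_le summable_ternary_code) (auto simp: indicator_def)
  then show "ternary_code B x \<le> 3 / 2"
    by (simp add: suminf_geometric)
qed

text \<open>At the first place \<open>k\<close> where the digits disagree the codes differ by
  \<open>(1/3)^k\<close>, and the later places can cancel at most half of that. Hence a gap below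
  \<open>(1/3)^N / 2\<close> forces agreement at every place up to \<open>N\<close>.\<close>

lemma ternary_code_separates:
  assumes near: "\<bar>ternary_code B x - ternary_code B y\<bar> < (1 / 3) ^ N / 2" and "i \<le> N"
  shows "x \<in> B i \<longleftrightarrow> y \<in> B i"
proof (rule ccontr)
  assume differ: "\<not> (x \<in> B i \<longleftrightarrow> y \<in> B i)"
  define k where "k = (LEAST i. \<not> (x \<in> B i \<longleftrightarrow> y \<in> B i))"
  have k: "\<not> (x \<in> B k \<longleftrightarrow> y \<in> B k)"
    unfolding k_def using differ by (rule LeastI)
  have "k \<le> N"
    using Least_le[where P = "\<lambda>i. \<not> (x \<in> B i \<longleftrightarrow> y \<in> B i)", OF differ] \<open>i \<le> N\<close> unfolding k_def by simp
  have before: "x \<in> B j \<longleftrightarrow> y \<in> B j" if "j < k" for j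
    using not_less_Least[of j "\<lambda>i. \<not> (x \<in> B i \<longleftrightarrow> y \<in> B i)"] that unfolding k_def by blast
  define d :: "nat \<Rightarrow> real" where
    "d j = indicator (B j) x * (1 / 3) ^ j - indicator (B j) y * (1 / 3) ^ j" for j
  have d_le: "\<bar>d j\<bar> \<le> (1 / 3) ^ j" for j
    by (auto simp: d_def indicator_def)
  have "summable d"
    unfolding d_def by (intro summable_diff summable_ternary_code)
  have "ternary_code B x - ternary_code B y = suminf d"
    unfolding ternary_code_def d_def by (intro suminf_diff summable_ternary_code)
  also have "\<dots> = (\<Sum>j. d (j + Suc k)) + (\<Sum>j<Suc k. d j)"
    using \<open>summable d\<close> by (rule suminf_split_initial_segment)
  also have "(\<Sum>j<Suc k. d j) = d k"
    using before by (simp add: d_def indicator_def)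
  finally have split: "ternary_code B x - ternary_code B y = (\<Sum>j. d (j + Suc k)) + d k" .
  have "norm (\<Sum>j. d (j + Suc k)) \<le> (\<Sum>j. (1 / 3) ^ Suc k * (1 / 3) ^ j)"
  proof (rule norm_suminf_le)
    show "norm (d (j + Suc k)) \<le> (1 / 3) ^ Suc k * (1 / 3) ^ j" for j
      using d_le[of "j + Suc k"] by (simp only: power_add real_norm_def mult.commute)
  qed (intro summable_mult, simp)
  also have "\<dots> = (1 / 3) ^ k / 2"
    by (subst suminf_mult) (simp_all add: suminf_geometric)
  finally have tail: "\<bar>\<Sum>j. d (j + Suc k)\<bar> \<le> (1 / 3) ^ k / 2"
    by simp
  have "\<bar>d k\<bar> = (1 / 3) ^ k"
    using k by (auto simp: d_def indicator_def)
  moreover have "(1 / 3 :: real) ^ N \<le> (1 / 3) ^ k"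
    using \<open>k \<le> N\<close> by (intro power_decreasing) auto
  ultimately show False
    using near tail split by linarith
qed

lemma borel_measurable_ternary_code:
  assumes "\<And>i. B i \<in> sets M"
  shows "ternary_code B \<in> borel_measurable M"
proof -
  note assms [measurable]
  show ?thesis
    unfolding ternary_code_def[abs_def] by measurable
qed

text \<open>
  The code of \<open>x\<close> consists of the index of the first \<open>K k\<close> containing it and of ternary digits that
  record membership in countably many balls. The factor 3 separates the codes belonging to different
  indices, so that a Cauchy sequence of codes comes from points of a single compact set.
\<close>

lemma sigma_compact_code:
  fixes K :: "nat \<Rightarrow> 'x::metric_space set"
  assumes K: "\<And>k. compact (K k)"
  obtains s :: "'x \<Rightarrow> real" and c :: "real \<Rightarrow> 'x" where
    "s \<in> borel_measurable borel"
    "\<And>k x. x \<in> K k \<Longrightarrow> 0 \<le> s x \<and> s x \<le> 3 * real k + 2"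
    "continuous_on (closure (s ` (\<Union>k. K k))) c"
    "\<And>x. x \<in> (\<Union>k. K k) \<Longrightarrow> c (s x) = x"
proof -
  define Y where "Y = (\<Union>k. K k)"
  have "\<forall>k m. \<exists>F. finite F \<and> K k \<subseteq> (\<Union>z\<in>F. ball z (1 / real (Suc m)))"
    using K by (metis compact_eq_totally_bounded zero_less_divide_1_iff of_nat_0_less_iff zero_less_Suc)
  then obtain F where F_fin: "\<And>k m. finite (F k m)"
    and F_cov: "\<And>k m. K k \<subseteq> (\<Union>z\<in>F k m. ball z (1 / real (Suc m)))"
    by metis
  \<comment> \<open>The balls come from finite nets of every \<open>K k\<close> at every scale.
    \<open>UNIV\<close> is inserted only to make the family nonempty, so that
    \<open>from_nat_into\<close> enumerates members of it.\<close>
  define \<B> where "\<B> = insert UNIV (\<Union>k. \<Union>m. (\<lambda>z. ball z (1 / real (Suc m))) ` F k m)"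
  have "countable \<B>"
    unfolding \<B>_def
    by (intro countable_insert countable_UN countable_image countable_finite[OF F_fin]) auto
  define B where "B = from_nat_into \<B>"
  have B_in: "B i \<in> \<B>" for i
    unfolding B_def by (rule from_nat_into) (simp add: \<B>_def)
  have B_meas: "B i \<in> sets borel" for i
    using B_in[of i] by (auto simp: \<B>_def)
  \<comment> \<open>Outside \<open>Y\<close> this index is an unspecified constant; it is meaningful
    only on the union of the compact sets.\<close>
  define u where "u x = (LEAST k. x \<in> K k)" for x
  have u_in: "x \<in> K (u x)" if "x \<in> Y" for x
    using that unfolding Y_def u_def by (auto intro: LeastI)
  have u_le: "u x \<le> k" if "x \<in> K k" for x k
    using that unfolding u_def by (rule Least_le)
  define s where "s x = 3 * real (u x) + ternary_code B x" for x
  have same_u: "u x = u y" if "\<bar>s x - s y\<bar> < 1" for x y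
  proof (rule ccontr)
    assume "u x \<noteq> u y"
    then have "\<bar>real (u x) - real (u y)\<bar> \<ge> 1"
      by linarith
    then show False
      using that ternary_code_bounds[of B x] ternary_code_bounds[of B y] unfolding s_def by linarith
  qed
  have s_meas: "s \<in> borel_measurable borel"
  proof -
    have [measurable]: "K k \<in> sets borel" for k
      using K by (simp add: compact_imp_closed borel_closed)
    note borel_measurable_ternary_code[OF B_meas, measurable]
    show ?thesis
      unfolding s_def[abs_def] u_def by measurable
  qed
  have s_bound: "0 \<le> s x \<and> s x \<le> 3 * real k + 2" if "x \<in> K k" for k x
    using u_le[OF that] ternary_code_bounds[of B x] unfolding s_def by simp
  \<comment> \<open>The inverse of \<open>s\<close> is uniformly continuous where the index is
    \<open>k\<close>: a finite net of \<open>K k\<close> involves finitely many digits only.\<close>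
  have unif: "\<exists>\<delta>>0. \<forall>x\<in>Y. \<forall>y\<in>Y. u x = k \<longrightarrow> \<bar>s x - s y\<bar> < \<delta> \<longrightarrow> dist x y < e"
    if "0 < e" for k and e :: real
  proof -
    obtain m where m: "2 / real (Suc m) < e"
      using reals_Archimedean[of "e / 2"] \<open>0 < e\<close> by (auto simp: field_simps)
    \<comment> \<open>The last digit recording a ball of the net. Agreement up to \<open>N\<close>
      puts \<open>y\<close> into the ball chosen for \<open>x\<close>; the bound 1 in the minimum
      makes the indices equal, so that the gap in \<open>s\<close> is a gap between ternary
      codes.\<close>
    define N where "N = Max (to_nat_on \<B> ` (\<lambda>z. ball z (1 / real (Suc m))) ` F k m)"
    have "dist x y < e"
      if "x \<in> Y" "y \<in> Y" "u x = k" and near: "\<bar>s x - s y\<bar> < min 1 ((1 / 3) ^ N / 2)" for x y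
    proof -
      obtain z where z: "z \<in> F k m" "x \<in> ball z (1 / real (Suc m))"
        using F_cov u_in[OF \<open>x \<in> Y\<close>] \<open>u x = k\<close> by blast
      define i where "i = to_nat_on \<B> (ball z (1 / real (Suc m)))"
      have "i \<le> N"
        unfolding i_def N_def using z F_fin by (intro Max_ge) auto
      have Bi: "B i = ball z (1 / real (Suc m))"
        unfolding B_def i_def
        by (rule from_nat_into_to_nat_on[OF \<open>countable \<B>\<close>]) (use z in \<open>auto simp: \<B>_def\<close>)
      have "u x = u y"
        using near by (intro same_u) simp
      then have "\<bar>ternary_code B x - ternary_code B y\<bar> < (1 / 3) ^ N / 2"
        using near unfolding s_def by simp
      from ternary_code_separates[OF this \<open>i \<le> N\<close>] have "y \<in> ball z (1 / real (Suc m))"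
        using z Bi by simp
      then have "dist x y < 1 / real (Suc m) + 1 / real (Suc m)"
        using z(2) dist_triangle_less_add[of x z "1 / real (Suc m)" y "1 / real (Suc m)"] by (simp add: dist_commute)
      then show ?thesis
        using m by simp
    qed
    then show ?thesis
      by (intro exI[of _ "min 1 ((1 / 3) ^ N / 2)"]) auto
  qed
  \<comment> \<open>This \<open>z\<close> will be the value of \<open>c\<close> at \<open>t\<close>.
    Codes close to \<open>t\<close> share one index \<open>k\<close>, so their preimages form a
    Cauchy sequence inside \<open>K k\<close>, and completeness of this compact set, not of the
    space, supplies the limit.\<close>
  have "\<exists>z. \<forall>e>0. \<exists>\<delta>>0. \<forall>x\<in>Y. \<bar>s x - t\<bar> < \<delta> \<longrightarrow> dist x z < e" if t: "t \<in> closure (s ` Y)" for t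
  proof -
    obtain \<sigma> where \<sigma>: "\<And>n. \<sigma> n \<in> s ` Y" "\<sigma> \<longlonglongrightarrow> t"
      using t by (auto simp: closure_sequential)
    then have "\<forall>n. \<exists>x\<in>Y. \<sigma> n = s x"
      by auto
    then obtain \<xi> where \<xi>: "\<And>n. \<xi> n \<in> Y" "\<And>n. \<sigma> n = s (\<xi> n)"
      by metis
    have near: "\<exists>N. \<forall>n\<ge>N. \<bar>s (\<xi> n) - t\<bar> < e" if "0 < e" for e
      using LIMSEQ_D[OF \<sigma>(2) that] \<xi>(2) by simp
    obtain N0 where N0: "\<And>n. n \<ge> N0 \<Longrightarrow> \<bar>s (\<xi> n) - t\<bar> < 1 / 2"
      using near[of "1 / 2"] by auto
    define k where "k = u (\<xi> N0)"
    have u_eq: "u (\<xi> n) = k" if "n \<ge> N0" for n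
      unfolding k_def using N0[OF that] N0[OF order_refl] by (intro same_u) linarith
    define \<xi>' where "\<xi>' n = \<xi> (n + N0)" for n
    have \<xi>'_in: "\<xi>' n \<in> K k" for n
      using u_in[OF \<xi>(1)[of "n + N0"]] u_eq[of "n + N0"] by (simp add: \<xi>'_def)
    have "Cauchy \<xi>'"
    proof (rule metric_CauchyI)
      fix e :: real assume "0 < e"
      from unif[OF this, of k] obtain \<delta> where \<delta>: "\<delta> > 0"
        "\<And>x y. x \<in> Y \<Longrightarrow> y \<in> Y \<Longrightarrow> u x = k \<Longrightarrow> \<bar>s x - s y\<bar> < \<delta> \<Longrightarrow> dist x y < e"
        by auto
      obtain N where N: "\<And>n. n \<ge> N \<Longrightarrow> \<bar>s (\<xi> n) - t\<bar> < \<delta> / 2"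
        using near[of "\<delta> / 2"] \<delta>(1) by auto
      have "dist (\<xi>' m) (\<xi>' n) < e" if "m \<ge> N" "n \<ge> N" for m n
        unfolding \<xi>'_def
        by (rule \<delta>(2)[OF \<xi>(1) \<xi>(1) u_eq]) (use N[of "m + N0"] N[of "n + N0"] that in \<open>simp; linarith\<close>)+
      then show "\<exists>M. \<forall>m\<ge>M. \<forall>n\<ge>M. dist (\<xi>' m) (\<xi>' n) < e"
        by blast
    qed
    then obtain z where z: "\<xi>' \<longlonglongrightarrow> z"
      using compact_imp_complete[OF K[of k]] \<xi>'_in unfolding complete_def by blast
    \<comment> \<open>The limit does not depend on the chosen sequence: by \<open>unif\<close>, any
      point of \<open>Y\<close> with code near \<open>t\<close> is close to a late member of
      \<open>\<xi>'\<close>.\<close>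
    have "\<exists>\<delta>>0. \<forall>x\<in>Y. \<bar>s x - t\<bar> < \<delta> \<longrightarrow> dist x z < e" if "0 < e" for e
    proof -
      from unif[of "e / 2" k] that obtain \<delta> where \<delta>: "\<delta> > 0"
        "\<And>x y. x \<in> Y \<Longrightarrow> y \<in> Y \<Longrightarrow> u x = k \<Longrightarrow> \<bar>s x - s y\<bar> < \<delta> \<Longrightarrow> dist x y < e / 2"
        by auto
      obtain N where N: "\<And>n. n \<ge> N \<Longrightarrow> \<bar>s (\<xi> n) - t\<bar> < \<delta> / 2"
        using near[of "\<delta> / 2"] \<delta>(1) by auto
      obtain N' where N': "\<And>n. n \<ge> N' \<Longrightarrow> dist (\<xi>' n) z < e / 2"
        using metric_LIMSEQ_D[OF z, of "e / 2"] \<open>0 < e\<close> by auto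
      define n where "n = max N N'"
      have "dist x z < e" if "x \<in> Y" "\<bar>s x - t\<bar> < \<delta> / 2" for x
      proof -
        have "dist (\<xi>' n) x < e / 2"
          unfolding \<xi>'_def
        proof (intro \<delta>(2) \<xi>(1) u_eq that(1))
          have "\<bar>s (\<xi> (n + N0)) - t\<bar> < \<delta> / 2"
            by (rule N) (simp add: n_def)
          then show "\<bar>s (\<xi> (n + N0)) - s x\<bar> < \<delta>"
            using that(2) by linarith
        qed simp
        moreover have "dist (\<xi>' n) z < e / 2"
          by (rule N') (simp add: n_def)
        ultimately show ?thesis
          using dist_triangle3[of x z "\<xi>' n"] by (simp add: dist_commute)
      qed
      then show ?thesis
        using \<delta>(1) by (intro exI[of _ "\<delta> / 2"]) auto
    qed
    then show ?thesis
      by blast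
  qed
  then have "\<exists>c. \<forall>t\<in>closure (s ` Y). \<forall>e>0. \<exists>\<delta>>0. \<forall>x\<in>Y. \<bar>s x - t\<bar> < \<delta> \<longrightarrow> dist x (c t) < e"
    by metis
  then obtain c where c: "\<And>t e. t \<in> closure (s ` Y) \<Longrightarrow> 0 < e \<Longrightarrow>
      \<exists>\<delta>>0. \<forall>x\<in>Y. \<bar>s x - t\<bar> < \<delta> \<longrightarrow> dist x (c t) < e"
    by metis
  have c_s: "c (s x) = x" if "x \<in> Y" for x
  proof (rule ccontr)
    assume "c (s x) \<noteq> x"
    then have "0 < dist x (c (s x))"
      by simp
    moreover have "s x \<in> closure (s ` Y)"
      by (rule subsetD[OF closure_subset imageI[OF that]])
    ultimately show False
      using c[of "s x" "dist x (c (s x))"] that by fastforce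
  qed
  \<comment> \<open>The values at \<open>t\<close> and \<open>t'\<close> are compared through one
    point of \<open>Y\<close> whose code is close to both.\<close>
  have "continuous_on (closure (s ` Y)) c"
  proof (rule continuous_onI)
    fix t and e :: real
    assume t: "t \<in> closure (s ` Y)" and "0 < e"
    then obtain \<delta> where \<delta>: "\<delta> > 0" "\<And>x. x \<in> Y \<Longrightarrow> \<bar>s x - t\<bar> < \<delta> \<Longrightarrow> dist x (c t) < e / 2"
      using c[of t "e / 2"] by auto
    have "dist (c t') (c t) \<le> e" if t': "t' \<in> closure (s ` Y)" "dist t' t < \<delta> / 2" for t'
    proof -
      obtain \<delta>' where \<delta>': "\<delta>' > 0" "\<And>x. x \<in> Y \<Longrightarrow> \<bar>s x - t'\<bar> < \<delta>' \<Longrightarrow> dist x (c t') < e / 2"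
        using c[of t' "e / 2"] t' \<open>0 < e\<close> by auto
      obtain x where x: "x \<in> Y" "dist (s x) t' < min (\<delta> / 2) \<delta>'"
        using closure_approachable[of t' "s ` Y"] t'(1) \<delta>(1) \<delta>'(1)
        by (metis (no_types, lifting) imageE min_less_iff_conj half_gt_zero)
      have "dist x (c t') < e / 2"
        using x by (intro \<delta>') (auto simp: dist_real_def)
      moreover have "dist x (c t) < e / 2"
        using x t'(2) unfolding dist_real_def by (intro \<delta>(2)) linarith+
      ultimately show ?thesis
        using dist_triangle3[of "c t'" "c t" x] by simp
    qed
    then show "\<exists>d>0. \<forall>x'\<in>closure (s ` Y). dist x' t < d \<longrightarrow> dist (c x') (c t) \<le> e"
      using \<delta>(1) by (intro exI[of _ "\<delta> / 2"]) auto
  qed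
  then show ?thesis
    using s_meas s_bound c_s unfolding Y_def by (intro that[of s c])
qed

text \<open>The laws are pushed to the real line by \<open>s\<close>, where tightness gives a weak
  limit \<open>M\<close> along a subsequence. \<open>M\<close> is concentrated on the closed set
  \<open>D\<close>, on which \<open>c\<close> is continuous, so \<open>M\<close> can be pushed back
  to the metric space.\<close>

theorem tight_imp_weakly_convergent_subsequence:
  fixes Q :: "nat \<Rightarrow> 'x::metric_space measure"
  assumes Q: "\<And>n. Q n \<in> distributions borel" and tight: "tight_dists (range Q)"
  obtains r Q0 where "strict_mono r" "Q0 \<in> distributions borel" "converges_weakly (Q \<circ> r) Q0"
proof -
  have "\<forall>k. \<exists>C. compact C \<and> (\<forall>n. measure (Q n) C > 1 - 1 / real (Suc k))"
    using tight unfolding tight_dists_def by auto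
  then obtain K where K: "\<And>k. compact (K k)"
    and K_mass: "\<And>k n. measure (Q n) (K k) > 1 - 1 / real (Suc k)"
    by metis
  define Y where "Y = (\<Union>k. K k)"
  obtain s c where s: "s \<in> borel_measurable borel"
    and s_bound: "\<And>k x. x \<in> K k \<Longrightarrow> 0 \<le> s x \<and> s x \<le> 3 * real k + 2"
    and c_cont: "continuous_on (closure (s ` Y)) c"
    and c_s: "\<And>x. x \<in> Y \<Longrightarrow> c (s x) = x"
    by (rule sigma_compact_code[OF K], rule that, unfold Y_def)
  define D where "D = closure (s ` Y)"
  have Q_prob: "prob_space (Q n)" and Q_sets [measurable_cong]: "sets (Q n) = sets borel" for n
    using Q[of n] by (auto simp: distributions_def)
  have Q_space: "space (Q n) = UNIV" for n
    using sets_eq_imp_space_eq[OF Q_sets] by simp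
  have s_Q: "s \<in> borel_measurable (Q n)" for n
    using s by (simp cong: measurable_cong_sets add: Q_sets)
  have K_meas: "K k \<in> sets borel" for k
    using K by (simp add: compact_imp_closed borel_closed)
  have Y_meas: "Y \<in> sets borel"
    unfolding Y_def using K_meas by auto
  have AE_Y: "AE x in Q n. x \<in> Y" for n
  proof -
    interpret prob_space "Q n" by (rule Q_prob)
    have "measure (Q n) Y \<ge> 1 - 1 / real (Suc k)" for k
      using K_mass[where k = k and n = n] finite_measure_mono[of "K k" Y] Y_meas unfolding Y_def
      by (fastforce simp: Q_sets)
    then have "measure (Q n) Y \<ge> 1"
    proof -
      have "(\<lambda>k. 1 - 1 / real (Suc k)) \<longlonglongrightarrow> 1 - 0"
        by (intro tendsto_intros LIMSEQ_inverse_real_of_nat[unfolded inverse_eq_divide])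
      then show ?thesis
        using \<open>\<And>k. measure (Q n) Y \<ge> 1 - 1 / real (Suc k)\<close> by (intro LIMSEQ_le_const2) auto
    qed
    then have "prob Y = 1"
      using prob_le_1[of Y] by simp
    then show ?thesis
      using prob_eq_1[of Y] Y_meas by (simp add: Q_sets)
  qed
  define \<mu> where "\<mu> n = distr (Q n) borel s" for n
  have \<mu>: "real_distribution (\<mu> n)" for n
  proof -
    interpret prob_space "Q n" by (rule Q_prob)
    show ?thesis
      unfolding \<mu>_def using s_Q by (rule real_distribution_distr)
  qed
  have "tight \<mu>"
    unfolding tight_def
  proof (intro conjI allI impI \<mu>)
    fix e :: real assume "0 < e"
    then obtain k where k: "1 / real (Suc k) < e"
      using reals_Archimedean[of e] by (auto simp: inverse_eq_divide)
    \<comment> \<open>The interval is open on the left and codes may equal 0, hence the left end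
      -1.\<close>
    have "1 - e < measure (\<mu> n) {-1<..3 * real k + 2}" for n
    proof -
      interpret prob_space "Q n" by (rule Q_prob)
      have "1 - e < measure (Q n) (K k)"
        using K_mass[where k = k and n = n] k by linarith
      also have "\<dots> \<le> measure (Q n) (s -` {-1<..3 * real k + 2} \<inter> space (Q n))"
        by (intro finite_measure_mono measurable_sets[OF s_Q])
          (auto simp: Q_space dest: s_bound)
      also have "\<dots> = measure (\<mu> n) {-1<..3 * real k + 2}"
        unfolding \<mu>_def using s_Q by (simp add: measure_distr)
      finally show ?thesis .
    qed
    then show "\<exists>a b. a < b \<and> (\<forall>n. 1 - e < measure (\<mu> n) {a<..b})"
      by (intro exI[of _ "-1"] exI[of _ "3 * real k + 2"]) auto
  qed
  from tight_imp_convergent_subsubsequence[OF this strict_mono_id]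
  obtain r M where r: "strict_mono r" and M: "real_distribution M" and conv: "weak_conv_m (\<mu> \<circ> r) M"
    by auto
  interpret M: real_distribution M by (rule M)
  have lim: "(\<lambda>n. \<integral>x. g (s x) \<partial>Q (r n)) \<longlonglongrightarrow> (\<integral>t. g t \<partial>M)"
    if g: "continuous_on UNIV g" "\<And>t. \<bar>g t\<bar> \<le> b" for g :: "real \<Rightarrow> real" and b
  proof -
    have "(\<lambda>n. integral\<^sup>L ((\<mu> \<circ> r) n) g) \<longlonglongrightarrow> integral\<^sup>L M g"
      using g by (intro weak_conv_imp_integral_bdd_continuous_conv[OF _ M conv, of g b])
        (auto simp: \<mu> continuous_on_eq_continuous_at)
    moreover have "integral\<^sup>L (\<mu> n) g = (\<integral>x. g (s x) \<partial>Q n)" for n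
      unfolding \<mu>_def using g(1) s_Q by (intro integral_distr borel_measurable_continuous_onI)
    ultimately show ?thesis
      by simp
  qed
  have s_D: "s x \<in> D" if "x \<in> Y" for x
    unfolding D_def by (rule subsetD[OF closure_subset imageI[OF that]])
  \<comment> \<open>The distance to the empty set is 0 by convention, so a zero of
    \<open>infdist\<close> identifies a point of \<open>D\<close> only if \<open>D\<close> is
    nonempty.\<close>
  have "D \<noteq> {}"
  proof -
    interpret prob_space "Q 0" by (rule Q_prob)
    have "Y \<noteq> {}"
      using AE_Y[of 0] by (auto simp: AE_False)
    then show ?thesis
      using s_D by auto
  qed
  have AE_D: "AE t in M. t \<in> D"
  proof -
    \<comment> \<open>A bounded continuous test function vanishing exactly on \<open>D\<close>. Its
      integral is 0 along the sequence, hence 0 under \<open>M\<close>.\<close>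
    define g where "g t = min 1 (infdist t D)" for t
    have g_cont: "continuous_on UNIV g"
      unfolding g_def by (intro continuous_intros)
    have g_bound: "0 \<le> g t" "\<bar>g t\<bar> \<le> 1" for t
      using infdist_nonneg[of t D] by (auto simp: g_def)
    have "(\<integral>x. g (s x) \<partial>Q n) = 0" for n
    proof -
      have "AE x in Q n. g (s x) = 0"
        using AE_Y[of n] by eventually_elim (simp add: g_def s_D)
      then show ?thesis
        by (rule integral_eq_zero_AE)
    qed
    then have "(\<integral>t. g t \<partial>M) = 0"
      using lim[OF g_cont g_bound(2)] by (simp add: LIMSEQ_const_iff)
    moreover have "integrable M g"
      using g_cont g_bound(2) borel_measurable_continuous_onI[OF g_cont] by (intro M.integrable_const_bound[of _ 1]) auto
    ultimately have "AE t in M. g t = 0"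
      using integral_nonneg_eq_0_iff_AE[of M g] g_bound(1) by simp
    then show ?thesis
    proof eventually_elim
      case (elim t)
      then have "infdist t D = 0"
        by (auto simp: g_def min_def split: if_splits)
      then show ?case
        using in_closed_iff_infdist_zero[of D t] \<open>D \<noteq> {}\<close> by (simp add: D_def)
    qed
  qed
  \<comment> \<open>\<open>c\<close> is controlled on \<open>D\<close> only; a constant value off
    this closed set makes the map Borel on the whole line.\<close>
  define c' where "c' t = (if t \<in> D then c t else undefined)" for t
  have D_meas: "D \<in> sets borel"
    by (simp add: D_def)
  have c': "c' \<in> borel_measurable borel"
    unfolding c'_def[abs_def] using D_meas c_cont[folded D_def]
    by (intro borel_measurable_continuous_on_if continuous_on_const)
  define Q0 where "Q0 = distr M borel c'"
  have "Q0 \<in> distributions borel"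
    unfolding Q0_def distributions_def using c' by (auto intro: M.prob_space_distr)
  moreover have "converges_weakly (Q \<circ> r) Q0"
    unfolding converges_weakly_def
  proof (intro allI impI, elim conjE)
    fix f :: "'x \<Rightarrow> real"
    assume f: "continuous_on UNIV f" "bounded (range f)"
    then obtain b where "0 < b" and b: "\<And>x. norm (f x) \<le> b"
      unfolding bounded_pos by auto
    have "continuous_on D (\<lambda>t. f (c t))"
      using c_cont continuous_on_compose2[OF f(1)] unfolding D_def by blast
    \<comment> \<open>Convergence on the line tests functions defined everywhere, so the composition
      of \<open>f\<close> with \<open>c\<close> is extended from \<open>D\<close> by Tietze, keeping
      the bound \<open>b\<close>. On \<open>Y\<close> the extension composed with \<open>s\<close>
      is \<open>f\<close> again.\<close>
    then obtain g where g: "continuous_on UNIV g" "\<And>t. t \<in> D \<Longrightarrow> g t = f (c t)" "\<And>t. norm (g t) \<le> b"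
      using Tietze[of D "\<lambda>t. f (c t)" UNIV b] b \<open>0 < b\<close> by (auto simp: D_def)
    have "(\<integral>x. g (s x) \<partial>Q n) = (\<integral>x. f x \<partial>Q n)" for n
    proof (rule integral_cong_AE)
      show "(\<lambda>x. g (s x)) \<in> borel_measurable (Q n)"
        using s_Q borel_measurable_continuous_onI[OF g(1)] by (rule measurable_compose)
      show "f \<in> borel_measurable (Q n)"
        using borel_measurable_continuous_onI[OF f(1)] by (simp cong: measurable_cong_sets add: Q_sets)
      show "AE x in Q n. g (s x) = f x"
        using AE_Y[of n] by eventually_elim (simp add: g(2) s_D c_s)
    qed
    moreover have "(\<integral>t. g t \<partial>M) = (\<integral>x. f x \<partial>Q0)"
    proof -
      have "(\<integral>t. g t \<partial>M) = (\<integral>t. f (c' t) \<partial>M)"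
      proof (rule integral_cong_AE)
        show "g \<in> borel_measurable M"
          using borel_measurable_continuous_onI[OF g(1)] by simp
        show "(\<lambda>t. f (c' t)) \<in> borel_measurable M"
          using measurable_compose[OF c' borel_measurable_continuous_onI[OF f(1)]] by simp
        show "AE t in M. g t = f (c' t)"
          using AE_D by eventually_elim (simp add: g(2) c'_def)
      qed
      also have "\<dots> = (\<integral>x. f x \<partial>Q0)"
        unfolding Q0_def using c' f(1)
        by (subst integral_distr) (auto intro: borel_measurable_continuous_onI)
      finally show ?thesis .
    qed
    ultimately show "(\<lambda>n. integral\<^sup>L ((Q \<circ> r) n) f) \<longlonglongrightarrow> integral\<^sup>L Q0 f"
      using lim[OF g(1), of b] g(3) by simp
  qed
  ultimately show ?thesis
    using that r by blast
qed

section \<open>Mixtures\<close>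

text \<open>The mixture \<open>R\<close> is known only through its values on sets. These are the
  indicator case of an induction over Borel functions, in which both sides respect sums, scaling and
  increasing limits.\<close>

lemma nn_integral_mixture:
  fixes t :: real
  assumes P: "prob_space P" and Q: "prob_space Q" and R: "prob_space R"
    and Q_sets: "sets Q = sets P" and R_sets: "sets R = sets P"
    and t: "0 \<le> t" "t \<le> 1"
    and mix: "\<And>B. B \<in> sets P \<Longrightarrow> measure R B = (1 - t) * measure P B + t * measure Q B"
    and f: "f \<in> borel_measurable P"
  shows "(\<integral>\<^sup>+ x. f x \<partial>R) = ennreal (1 - t) * (\<integral>\<^sup>+ x. f x \<partial>P) + ennreal t * (\<integral>\<^sup>+ x. f x \<partial>Q)"
  using f
proof (induction rule: borel_measurable_induct)
  case (cong f g)
  then have "(\<integral>\<^sup>+ x. f x \<partial>M) = (\<integral>\<^sup>+ x. g x \<partial>M)" if "sets M = sets P" for M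
    using sets_eq_imp_space_eq[OF that] by (intro nn_integral_cong) simp
  then show ?case
    using cong(4) Q_sets R_sets by simp
next
  case (set B)
  interpret P: prob_space P by (rule P)
  interpret Q: prob_space Q by (rule Q)
  interpret R: prob_space R by (rule R)
  show ?case
    using set t by (simp add: Q_sets R_sets mix P.emeasure_eq_measure Q.emeasure_eq_measure
        R.emeasure_eq_measure ennreal_mult ennreal_plus)
next
  case (mult u c)
  then have "u \<in> borel_measurable Q" "u \<in> borel_measurable R"
    by (simp_all cong: measurable_cong_sets add: Q_sets R_sets)
  then show ?case
    using mult by (simp add: nn_integral_cmult algebra_simps)
next
  case (add u v)
  then have "u \<in> borel_measurable Q" "u \<in> borel_measurable R"
    "v \<in> borel_measurable Q" "v \<in> borel_measurable R"
    by (simp_all cong: measurable_cong_sets add: Q_sets R_sets)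
  then show ?case
    using add by (simp add: nn_integral_add algebra_simps)
next
  case (seq U)
  have U: "U i \<in> borel_measurable P" "U i \<in> borel_measurable Q" "U i \<in> borel_measurable R" for i
    using seq(1) by (simp_all cong: measurable_cong_sets add: Q_sets R_sets)
  have sup: "(\<integral>\<^sup>+ x. (SUP i. U i) x \<partial>M) = (SUP i. \<integral>\<^sup>+ x. U i x \<partial>M)"
    if "\<And>i. U i \<in> borel_measurable M" for M
    using nn_integral_monotone_convergence_SUP[of U M, OF \<open>incseq U\<close> that]
    by (simp add: image_comp)
  have mono: "incseq (\<lambda>i. c * (\<integral>\<^sup>+ x. U i x \<partial>M))" for c :: ennreal and M
    using \<open>incseq U\<close> by (auto simp: incseq_def le_fun_def intro!: mult_left_mono nn_integral_mono)
  have "(\<integral>\<^sup>+ x. (SUP i. U i) x \<partial>R) =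
      (SUP i. ennreal (1 - t) * (\<integral>\<^sup>+ x. U i x \<partial>P) + ennreal t * (\<integral>\<^sup>+ x. U i x \<partial>Q))"
    unfolding sup[OF U(3)] by (simp only: seq.IH)
  also have "\<dots> = (SUP i. ennreal (1 - t) * (\<integral>\<^sup>+ x. U i x \<partial>P)) + (SUP i. ennreal t * (\<integral>\<^sup>+ x. U i x \<partial>Q))"
    by (intro ennreal_SUP_add mono)
  also have "\<dots> = ennreal (1 - t) * (\<integral>\<^sup>+ x. (SUP i. U i) x \<partial>P) + ennreal t * (\<integral>\<^sup>+ x. (SUP i. U i) x \<partial>Q)"
    unfolding sup[OF U(1)] sup[OF U(2)] by (simp only: SUP_mult_left_ennreal)
  finally show ?case .
qed

text \<open>The version for the bounded test functions of weak convergence: boundedness makes both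
  parts of \<open>f\<close> integrable, and each part mixes by the nonnegative case.\<close>

lemma integral_mixture:
  fixes f :: "'x \<Rightarrow> real" and t :: real
  assumes P: "prob_space P" and Q: "prob_space Q" and R: "prob_space R"
    and Q_sets: "sets Q = sets P" and R_sets: "sets R = sets P"
    and t: "0 \<le> t" "t \<le> 1"
    and mix: "\<And>B. B \<in> sets P \<Longrightarrow> measure R B = (1 - t) * measure P B + t * measure Q B"
    and f: "f \<in> borel_measurable P" "\<And>x. \<bar>f x\<bar> \<le> b"
  shows "integral\<^sup>L R f = (1 - t) * integral\<^sup>L P f + t * integral\<^sup>L Q f"
proof -
  have int: "integrable M f" if "prob_space M" "sets M = sets P" for M
  proof -
    interpret prob_space M by fact
    show ?thesis
      using f that(2) by (intro integrable_const_bound[of _ b]) (simp_all cong: measurable_cong_sets)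
  qed
  have fin: "(\<integral>\<^sup>+ x. ennreal (f x) \<partial>M) < \<infinity>" "(\<integral>\<^sup>+ x. ennreal (- f x) \<partial>M) < \<infinity>"
    if "prob_space M" "sets M = sets P" for M
    using int[OF that] unfolding real_integrable_def by (auto simp: less_top)
  have split: "enn2real (ennreal (1 - t) * u + ennreal t * v) = (1 - t) * enn2real u + t * enn2real v"
    if "u < \<infinity>" "v < \<infinity>" for u v
    using that t by (cases u; cases v) (simp_all flip: ennreal_mult ennreal_plus)
  have "f \<in> borel_measurable P"
    by (rule f)
  then have "(\<integral>\<^sup>+ x. ennreal (f x) \<partial>R) = ennreal (1 - t) * (\<integral>\<^sup>+ x. ennreal (f x) \<partial>P) + ennreal t * (\<integral>\<^sup>+ x. ennreal (f x) \<partial>Q)"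
    "(\<integral>\<^sup>+ x. ennreal (- f x) \<partial>R) = ennreal (1 - t) * (\<integral>\<^sup>+ x. ennreal (- f x) \<partial>P) + ennreal t * (\<integral>\<^sup>+ x. ennreal (- f x) \<partial>Q)"
    using t by (auto intro!: nn_integral_mixture[OF P Q R Q_sets R_sets _ _ mix])
  then show ?thesis
    using fin[OF P refl] fin[OF Q Q_sets]
    by (simp add: real_lebesgue_integral_def int P Q R Q_sets R_sets split) (simp add: algebra_simps)
qed

section \<open>Expected losses and Bayes acts\<close>

text \<open>
  Since \<^const>\<open>ennreal\<close> maps negative reals to 0, \<open>ennreal h\<close> and \<open>ennreal (- h)\<close> are the positive and
  negative part of \<open>h\<close>, and no subtraction occurs on the right.
\<close>

lemma ereal_le_enn2ereal_diff_iff: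
  assumes "\<not> (p = \<infinity> \<and> n = \<infinity>)"
  shows "ereal h \<le> enn2ereal p - enn2ereal n \<longleftrightarrow> ennreal h + n \<le> p + ennreal (- h)"
proof (cases p; cases n)
  fix a b :: real
  assume p: "p = ennreal a" "0 \<le> a" and n: "n = ennreal b" "0 \<le> b"
  have sums: "ennreal h + n = ennreal (max 0 h + b)" "p + ennreal (- h) = ennreal (a + max 0 (- h))"
    using p n by (auto simp: ennreal_plus max_def ennreal_neg)
  have "ereal h \<le> enn2ereal p - enn2ereal n \<longleftrightarrow> h \<le> a - b"
    using p n by (simp add: enn2ereal_ennreal)
  also have "\<dots> \<longleftrightarrow> max 0 h + b \<le> a + max 0 (- h)"
    by (auto simp: max_def)
  also have "\<dots> \<longleftrightarrow> ennreal h + n \<le> p + ennreal (- h)"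
    unfolding sums using p by (intro ennreal_le_iff[symmetric]) simp
  finally show ?thesis .
qed (use assms in \<open>auto simp: top_unique enn2ereal_ennreal\<close>)

text \<open>Tonelli in both orders, applied to a positive part. Integrating over acts first relates
  \<open>rand_exp_loss\<close> to \<open>rand_loss\<close>, and over states first to
  \<open>exp_loss\<close>.\<close>

lemma pos_part_int_pair:
  fixes f :: "'x \<times> 'a \<Rightarrow> ereal"
  assumes "prob_space P" "prob_space \<zeta>" and f: "f \<in> borel_measurable (P \<Otimes>\<^sub>M \<zeta>)"
  shows "pos_part_int (P \<Otimes>\<^sub>M \<zeta>) f = (\<integral>\<^sup>+ x. pos_part_int \<zeta> (\<lambda>a. f (x, a)) \<partial>P)"
    and "pos_part_int (P \<Otimes>\<^sub>M \<zeta>) f = (\<integral>\<^sup>+ a. pos_part_int P (\<lambda>x. f (x, a)) \<partial>\<zeta>)"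
    and "(\<lambda>x. pos_part_int \<zeta> (\<lambda>a. f (x, a))) \<in> borel_measurable P"
    and "(\<lambda>a. pos_part_int P (\<lambda>x. f (x, a))) \<in> borel_measurable \<zeta>"
proof -
  interpret P1: prob_space P by fact
  interpret \<zeta>: prob_space \<zeta> by fact
  interpret pair_sigma_finite P \<zeta> ..
  have g: "(\<lambda>z. e2ennreal (max 0 (f z))) \<in> borel_measurable (P \<Otimes>\<^sub>M \<zeta>)"
    using f by measurable
  show "pos_part_int (P \<Otimes>\<^sub>M \<zeta>) f = (\<integral>\<^sup>+ x. pos_part_int \<zeta> (\<lambda>a. f (x, a)) \<partial>P)"
    unfolding pos_part_int_def using \<zeta>.nn_integral_fst[OF g] by simp
  show "pos_part_int (P \<Otimes>\<^sub>M \<zeta>) f = (\<integral>\<^sup>+ a. pos_part_int P (\<lambda>x. f (x, a)) \<partial>\<zeta>)"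
    unfolding pos_part_int_def using nn_integral_snd[OF g]
    by simp
  show "(\<lambda>x. pos_part_int \<zeta> (\<lambda>a. f (x, a))) \<in> borel_measurable P"
    unfolding pos_part_int_def by (rule \<zeta>.borel_measurable_nn_integral_fst[OF g])
  show "(\<lambda>a. pos_part_int P (\<lambda>x. f (x, a))) \<in> borel_measurable \<zeta>"
    unfolding pos_part_int_def
    using P1.borel_measurable_nn_integral_fst[OF measurable_pair_swap[OF g]] by simp
qed

lemma pos_part_int_cong:
  "(\<And>x. x \<in> space M \<Longrightarrow> f x = g x) \<Longrightarrow> pos_part_int M f = pos_part_int M g"
  unfolding pos_part_int_def by (auto intro: nn_integral_cong)

section \<open>Point masses as randomized acts\<close>

lemma pos_part_int_return:
  assumes "a \<in> space A" "f \<in> borel_measurable A"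
  shows "pos_part_int (return A a) f = e2ennreal (max 0 (f a))"
  unfolding pos_part_int_def using assms
  by (intro nn_integral_return) (auto intro: borel_measurable_max measurable_compose[OF _ measurable_e2ennreal])

lemma ext_expect_return:
  assumes "a \<in> space A" "f \<in> borel_measurable A"
  shows "ext_expect (return A a) f = f a"
proof -
  have "pos_part_int (return A a) (\<lambda>x. - f x) = e2ennreal (max 0 (- f a))"
    using assms by (intro pos_part_int_return) measurable
  then show ?thesis
    unfolding ext_expect_def using assms
    by (cases "f a") (auto simp: pos_part_int_return enn2ereal_e2ennreal max_def zero_ennreal.rep_eq)
qed

lemma loss_measurable:
  assumes "basic_game X A L" "P \<in> distributions X" "\<zeta> \<in> distributions A"
  shows "(\<lambda>(x, a). L x a) \<in> borel_measurable (P \<Otimes>\<^sub>M \<zeta>)"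
    and "(\<lambda>z. - (case z of (x, a) \<Rightarrow> L x a)) \<in> borel_measurable (P \<Otimes>\<^sub>M \<zeta>)"
proof -
  have "sets (P \<Otimes>\<^sub>M \<zeta>) = sets (X \<Otimes>\<^sub>M A)"
    using assms by (intro sets_pair_measure_cong) (auto simp: distributions_def)
  then show 1: "(\<lambda>(x, a). L x a) \<in> borel_measurable (P \<Otimes>\<^sub>M \<zeta>)"
    using assms(1) by (simp cong: measurable_cong_sets add: basic_game_def)
  show "(\<lambda>z. - (case z of (x, a) \<Rightarrow> L x a)) \<in> borel_measurable (P \<Otimes>\<^sub>M \<zeta>)"
    using borel_measurable_uminus_ereal[OF 1] by simp
qed

lemma return_distribution: "a \<in> space A \<Longrightarrow> return A a \<in> distributions A"
  by (simp add: distributions_def prob_space_return)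

lemma loss_section_measurable:
  assumes "basic_game X A L" "x \<in> space X"
  shows "(\<lambda>a. L x a) \<in> borel_measurable A"
proof -
  have "(\<lambda>a. (\<lambda>(x, a). L x a) (x, a)) \<in> borel_measurable A"
    using assms by (intro measurable_compose[OF measurable_Pair1']) (auto simp: basic_game_def)
  then show ?thesis
    by simp
qed

lemma pos_part_int_pair_return:
  assumes "basic_game X A L" "P \<in> distributions X" and a: "a \<in> space A"
  shows "pos_part_int (P \<Otimes>\<^sub>M return A a) (\<lambda>(x, a). L x a) = pos_part_int P (\<lambda>x. L x a)"
    and "pos_part_int (P \<Otimes>\<^sub>M return A a) (\<lambda>z. - (case z of (x, a) \<Rightarrow> L x a)) =
      pos_part_int P (\<lambda>x. - L x a)"
proof -
  have prob: "prob_space P" "prob_space (return A a)" and space: "space P = space X"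
    using assms by (auto simp: distributions_def prob_space_return dest!: sets_eq_imp_space_eq)
  note meas = loss_measurable[OF assms(1,2) return_distribution[OF a]]
  have sec: "(\<lambda>b. L x b) \<in> borel_measurable A" "(\<lambda>b. - L x b) \<in> borel_measurable A" if "x \<in> space P" for x
    using loss_section_measurable[OF assms(1)] that space by auto
  show "pos_part_int (P \<Otimes>\<^sub>M return A a) (\<lambda>(x, a). L x a) = pos_part_int P (\<lambda>x. L x a)"
  proof -
    have "pos_part_int (P \<Otimes>\<^sub>M return A a) (\<lambda>(x, a). L x a) =
        (\<integral>\<^sup>+ x. pos_part_int (return A a) (\<lambda>b. L x b) \<partial>P)"
      using pos_part_int_pair(1)[OF prob meas(1)] by simp
    also have "\<dots> = pos_part_int P (\<lambda>x. L x a)"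
      unfolding pos_part_int_def[of P] by (intro nn_integral_cong pos_part_int_return a sec)
    finally show ?thesis .
  qed
  show "pos_part_int (P \<Otimes>\<^sub>M return A a) (\<lambda>z. - (case z of (x, a) \<Rightarrow> L x a)) =
      pos_part_int P (\<lambda>x. - L x a)"
  proof -
    have "pos_part_int (P \<Otimes>\<^sub>M return A a) (\<lambda>z. - (case z of (x, a) \<Rightarrow> L x a)) =
        (\<integral>\<^sup>+ x. pos_part_int (return A a) (\<lambda>b. - L x b) \<partial>P)"
      using pos_part_int_pair(1)[OF prob meas(2)] by simp
    also have "\<dots> = pos_part_int P (\<lambda>x. - L x a)"
      unfolding pos_part_int_def[of P] by (intro nn_integral_cong pos_part_int_return a sec)
    finally show ?thesis .
  qed
qed

text \<open>Pure acts embed into the randomized ones. The point mass is admissible because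
  \<open>game_dists\<close> requires \<open>L(P,a)\<close> to be defined for every act.\<close>

lemma pure_act:
  assumes "basic_game X A L" "a \<in> space A"
  shows "return A a \<in> rand_acts X A L"
    and "P \<in> distributions X \<Longrightarrow> rand_exp_loss L P (return A a) = exp_loss L P a"
    and "x \<in> space X \<Longrightarrow> rand_loss L x (return A a) = L x a"
  using assms pos_part_int_pair_return[OF assms(1) _ assms(2)] loss_section_measurable[OF assms(1)]
  by (auto simp: rand_acts_def return_distribution game_dists_def ext_expect_defined_def
      rand_exp_loss_def exp_loss_def ext_expect_def[of "_ \<Otimes>\<^sub>M _"] ext_expect_def[of _ "\<lambda>x. L x _"]
      rand_loss_def ext_expect_return)

text \<open>\<open>H(P) \<le> L(P,a)\<close> is averaged over \<open>a\<close> drawn from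
  \<open>\<zeta>\<close>. The inequality is first written without subtraction, so that nonnegative
  integrals apply even where a part of the loss is infinite.\<close>

lemma entropy_le_rand_exp_loss:
  assumes game: "basic_game X A L" and P: "P \<in> game_dists X A L" and \<zeta>: "\<zeta> \<in> rand_acts X A L"
    and fin: "\<bar>gen_entropy A L P\<bar> \<noteq> \<infinity>"
  shows "gen_entropy A L P \<le> rand_exp_loss L P \<zeta>"
proof -
  obtain h where h: "gen_entropy A L P = ereal h"
    using fin by (cases "gen_entropy A L P") auto
  have P': "P \<in> distributions X" and \<zeta>': "\<zeta> \<in> distributions A"
    and def: "ext_expect_defined (P \<Otimes>\<^sub>M \<zeta>) (\<lambda>(x, a). L x a)"
    using P \<zeta> by (auto simp: game_dists_def rand_acts_def)
  have prob: "prob_space P" "prob_space \<zeta>" and space: "space \<zeta> = space A"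
    using P' \<zeta>' by (auto simp: distributions_def dest!: sets_eq_imp_space_eq)
  interpret \<zeta>: prob_space \<zeta> by (rule prob)
  note meas = loss_measurable[OF game P' \<zeta>']
  define p where "p a = pos_part_int P (\<lambda>x. L x a)" for a
  define n where "n a = pos_part_int P (\<lambda>x. - L x a)" for a
  have pn_meas: "p \<in> borel_measurable \<zeta>" "n \<in> borel_measurable \<zeta>"
    using pos_part_int_pair(4)[OF prob meas(1)] pos_part_int_pair(4)[OF prob meas(2)]
    by (simp_all add: p_def[abs_def] n_def[abs_def])
  have "ennreal h + n a \<le> p a + ennreal (- h)" if "a \<in> space \<zeta>" for a
  proof -
    have "\<not> (p a = \<infinity> \<and> n a = \<infinity>)"
      using P that space by (auto simp: game_dists_def ext_expect_defined_def p_def n_def)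
    moreover have "ereal h \<le> enn2ereal (p a) - enn2ereal (n a)"
      using INF_lower[of a "space A" "exp_loss L P"] that space h
      by (simp add: gen_entropy_def exp_loss_def ext_expect_def p_def n_def)
    ultimately show ?thesis
      by (simp add: ereal_le_enn2ereal_diff_iff)
  qed
  then have "(\<integral>\<^sup>+ a. ennreal h + n a \<partial>\<zeta>) \<le> (\<integral>\<^sup>+ a. p a + ennreal (- h) \<partial>\<zeta>)"
    by (intro nn_integral_mono)
  then have "ennreal h + integral\<^sup>N \<zeta> n \<le> integral\<^sup>N \<zeta> p + ennreal (- h)"
    using pn_meas by (simp add: nn_integral_add \<zeta>.emeasure_space_1)
  moreover have "integral\<^sup>N \<zeta> p = pos_part_int (P \<Otimes>\<^sub>M \<zeta>) (\<lambda>(x, a). L x a)"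
    "integral\<^sup>N \<zeta> n = pos_part_int (P \<Otimes>\<^sub>M \<zeta>) (\<lambda>z. - (case z of (x, a) \<Rightarrow> L x a))"
    using pos_part_int_pair(2)[OF prob meas(1)] pos_part_int_pair(2)[OF prob meas(2)]
    by (simp_all add: p_def[abs_def] n_def[abs_def])
  ultimately show ?thesis
    using def unfolding h rand_exp_loss_def ext_expect_def ext_expect_defined_def
    by (subst ereal_le_enn2ereal_diff_iff) auto
qed

text \<open>
  This is \<open>d = f - (u - v)\<close> with every term moved to the side where it is nonnegative, so that it
  remains true, and can be integrated term by term, when \<open>u\<close> or \<open>v\<close> is infinite.
\<close>

lemma parts_of_difference:
  fixes u v :: ennreal and f :: ereal
  assumes "\<bar>f\<bar> \<noteq> \<infinity>" "\<not> (u = \<infinity> \<and> v = \<infinity>)"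
  defines "d \<equiv> f - (enn2ereal u - enn2ereal v)"
  shows "e2ennreal (max 0 f) + v + e2ennreal (max 0 (- d)) =
    e2ennreal (max 0 (- f)) + u + e2ennreal (max 0 d)"
proof -
  obtain r where r: "f = ereal r"
    using assms(1) by (cases f) auto
  have parts: "e2ennreal (max 0 (ereal y)) = ennreal (max 0 y)" for y
    by (metis e2ennreal_ereal ereal_max zero_ereal_def)
  show ?thesis
  proof (cases u; cases v)
    fix a b :: real
    assume u: "u = ennreal a" "0 \<le> a" and v: "v = ennreal b" "0 \<le> b"
    have d: "d = ereal (r - (a - b))"
      using u v r by (simp add: d_def enn2ereal_ennreal)
    have "max 0 r + b + max 0 (- (r - (a - b))) = max 0 (- r) + a + max 0 (r - (a - b))"
      by (simp add: max_def)
    then show ?thesis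
      using u v unfolding r d uminus_ereal.simps parts
      by (simp flip: ennreal_plus del: ennreal_max_0 ennreal_max_0')
  qed (use assms(2) r in \<open>auto simp: d_def enn2ereal_ennreal\<close>)
qed

text \<open>The Bayes property, tested against the point mass at \<open>a\<close>, says only that
  the expected difference of losses is nonnegative; it has to be split into two expectations. If the
  positive part of \<open>L(x,a)\<close> has infinite integral the bound is trivial. Otherwise
  finite entropy makes \<open>L(x,a)\<close> finite almost everywhere, and the parts can be
  rearranged and integrated.\<close>

lemma bayes_act_le_entropy:
  assumes game: "basic_game X A L" and P: "P \<in> game_dists X A L" and bayes: "bayes_act X A L P \<zeta>"
    and fin: "\<bar>gen_entropy A L P\<bar> \<noteq> \<infinity>"
  shows "rand_exp_loss L P \<zeta> \<le> gen_entropy A L P"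
  unfolding gen_entropy_def
proof (rule INF_greatest)
  fix a assume a: "a \<in> space A"
  have P': "P \<in> distributions X" and \<zeta>': "\<zeta> \<in> distributions A"
    and def: "ext_expect_defined (P \<Otimes>\<^sub>M \<zeta>) (\<lambda>(x, a). L x a)"
    using P bayes by (auto simp: game_dists_def bayes_act_def rand_acts_def)
  have prob: "prob_space P" "prob_space \<zeta>" and space: "space P = space X"
    using P' \<zeta>' by (auto simp: distributions_def dest!: sets_eq_imp_space_eq)
  note meas = loss_measurable[OF game P' \<zeta>']
  define u where "u x = pos_part_int \<zeta> (\<lambda>a. L x a)" for x
  define v where "v x = pos_part_int \<zeta> (\<lambda>a. - L x a)" for x
  have uv [measurable]: "u \<in> borel_measurable P" "v \<in> borel_measurable P"
    using pos_part_int_pair(3)[OF prob meas(1)] pos_part_int_pair(3)[OF prob meas(2)]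
    by (simp_all add: u_def[abs_def] v_def[abs_def])
  have uv_int: "pos_part_int (P \<Otimes>\<^sub>M \<zeta>) (\<lambda>(x, a). L x a) = integral\<^sup>N P u"
    "pos_part_int (P \<Otimes>\<^sub>M \<zeta>) (\<lambda>z. - (case z of (x, a) \<Rightarrow> L x a)) = integral\<^sup>N P v"
    using pos_part_int_pair(1)[OF prob meas(1)] pos_part_int_pair(1)[OF prob meas(2)]
    by (simp_all add: u_def[abs_def] v_def[abs_def])
  have uv_def: "\<not> (integral\<^sup>N P u = \<infinity> \<and> integral\<^sup>N P v = \<infinity>)"
    using def by (simp add: ext_expect_defined_def uv_int)
  have loss: "rand_loss L x \<zeta> = enn2ereal (u x) - enn2ereal (v x)" for x
    by (simp add: rand_loss_def ext_expect_def u_def v_def)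
  define f where "f x = L x a" for x
  define p where "p = pos_part_int P f"
  define n where "n = pos_part_int P (\<lambda>x. - f x)"
  have f [measurable]: "f \<in> borel_measurable P"
  proof -
    have "(\<lambda>x. (\<lambda>(x, a). L x a) (x, a)) \<in> borel_measurable X"
      using a game by (intro measurable_compose[OF measurable_Pair2']) (auto simp: basic_game_def)
    then show ?thesis
      using P' by (simp add: f_def[abs_def] distributions_def cong: measurable_cong_sets)
  qed
  have pn_def: "\<not> (p = \<infinity> \<and> n = \<infinity>)"
    using P a by (auto simp: game_dists_def ext_expect_defined_def p_def n_def f_def[abs_def])
  have exp: "exp_loss L P a = enn2ereal p - enn2ereal n"
    by (simp add: exp_loss_def ext_expect_def p_def n_def f_def[abs_def])
  have above: "gen_entropy A L P \<le> exp_loss L P a"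
    unfolding gen_entropy_def using a by (rule INF_lower)
  define d where "d x = f x - (enn2ereal (u x) - enn2ereal (v x))" for x
  have d_meas [measurable]: "d \<in> borel_measurable P"
    unfolding d_def[abs_def] by measurable
  have d_eq: "d x = rand_loss L x (return A a) - rand_loss L x \<zeta>" if "x \<in> space P" for x
    using pure_act(3)[OF game a] that space by (simp add: d_def f_def loss)
  have "ext_expect_defined P (\<lambda>x. rand_loss L x (return A a) - rand_loss L x \<zeta>)"
    "0 \<le> ext_expect P (\<lambda>x. rand_loss L x (return A a) - rand_loss L x \<zeta>)"
    using bayes pure_act(1)[OF game a] by (auto simp: bayes_act_def)
  then have d_def': "\<not> (pos_part_int P d = \<infinity> \<and> pos_part_int P (\<lambda>x. - d x) = \<infinity>)"
    and d_nonneg: "0 \<le> enn2ereal (pos_part_int P d) - enn2ereal (pos_part_int P (\<lambda>x. - d x))"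
    using pos_part_int_cong[of P d "\<lambda>x. rand_loss L x (return A a) - rand_loss L x \<zeta>"]
      pos_part_int_cong[of P "\<lambda>x. - d x" "\<lambda>x. - (rand_loss L x (return A a) - rand_loss L x \<zeta>)"]
    by (simp_all add: d_eq ext_expect_defined_def ext_expect_def)
  have d_le: "pos_part_int P (\<lambda>x. - d x) \<le> pos_part_int P d"
    using d_nonneg ereal_le_enn2ereal_diff_iff[OF d_def', of 0] by (simp add: zero_ereal_def)
  \<comment> \<open>This finiteness later permits cancelling the integral of the negative part of
    \<open>d\<close> from both sides.\<close>
  then have d_fin: "pos_part_int P (\<lambda>x. - d x) < \<infinity>"
    using d_def' by (auto simp: less_top top_unique)
  show "rand_exp_loss L P \<zeta> \<le> exp_loss L P a"
  proof (cases "p = \<infinity>")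
    case True
    then show ?thesis
      using pn_def by (cases n) (auto simp: exp enn2ereal_ennreal)
  next
    case False
    \<comment> \<open>Otherwise \<open>L(P,a)\<close> would be \<open>-\<infinity>\<close>, below
      the finite entropy.\<close>
    have n_fin: "n \<noteq> \<infinity>"
      using False above fin unfolding exp by (cases p) (auto simp: enn2ereal_ennreal)
    have f_fin: "AE x in P. \<bar>f x\<bar> \<noteq> \<infinity>"
    proof -
      have "AE x in P. e2ennreal (max 0 (f x)) \<noteq> \<infinity>"
        using False unfolding p_def pos_part_int_def by (intro nn_integral_PInf_AE) measurable
      moreover have "AE x in P. e2ennreal (max 0 (- f x)) \<noteq> \<infinity>"
        using n_fin unfolding n_def pos_part_int_def by (intro nn_integral_PInf_AE) measurable
      ultimately show ?thesis
        by eventually_elim (auto simp: max_def)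
    qed
    \<comment> \<open>Definedness of \<open>L(P,\<zeta>)\<close> makes one of the two integrals
      finite, hence that integrand finite almost everywhere.\<close>
    have uv_fin: "AE x in P. \<not> (u x = \<infinity> \<and> v x = \<infinity>)"
    proof (cases "integral\<^sup>N P u = \<infinity>")
      case True
      then have "AE x in P. v x \<noteq> \<infinity>"
        using uv_def by (intro nn_integral_PInf_AE) auto
      then show ?thesis
        by eventually_elim simp
    next
      case False
      then have "AE x in P. u x \<noteq> \<infinity>"
        by (intro nn_integral_PInf_AE) auto
      then show ?thesis
        by eventually_elim simp
    qed
    have "(\<integral>\<^sup>+ x. e2ennreal (max 0 (f x)) + v x + e2ennreal (max 0 (- d x)) \<partial>P) =
        (\<integral>\<^sup>+ x. e2ennreal (max 0 (- f x)) + u x + e2ennreal (max 0 (d x)) \<partial>P)"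
    proof (rule nn_integral_cong_AE)
      show "AE x in P. e2ennreal (max 0 (f x)) + v x + e2ennreal (max 0 (- d x)) =
          e2ennreal (max 0 (- f x)) + u x + e2ennreal (max 0 (d x))"
        using f_fin uv_fin unfolding d_def by eventually_elim (rule parts_of_difference)
    qed
    then have "p + integral\<^sup>N P v + pos_part_int P (\<lambda>x. - d x) = n + integral\<^sup>N P u + pos_part_int P d"
      by (simp add: nn_integral_add p_def n_def pos_part_int_def)
    then have "n + integral\<^sup>N P u + pos_part_int P (\<lambda>x. - d x) \<le>
        p + integral\<^sup>N P v + pos_part_int P (\<lambda>x. - d x)"
      using d_le by (metis add_left_mono)
    then have le: "n + integral\<^sup>N P u \<le> p + integral\<^sup>N P v"
      using d_fin by (auto simp: ennreal_add_left_cancel_le add.commute[of _ "pos_part_int P (\<lambda>x. - d x)"])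
    have "enn2ereal (integral\<^sup>N P u) - enn2ereal (integral\<^sup>N P v) \<le> enn2ereal p - enn2ereal n"
    proof (cases p; cases n; cases "integral\<^sup>N P u"; cases "integral\<^sup>N P v")
      fix p' n' u' v' :: real
      assume *: "p = ennreal p'" "n = ennreal n'" "integral\<^sup>N P u = ennreal u'"
        "integral\<^sup>N P v = ennreal v'" "0 \<le> p'" "0 \<le> n'" "0 \<le> u'" "0 \<le> v'"
      then have "n' + u' \<le> p' + v'"
        using le by (simp flip: ennreal_plus)
      then show ?thesis
        using * by (simp add: enn2ereal_ennreal)
    qed (use uv_def n_fin False le in \<open>auto simp: enn2ereal_ennreal top_unique\<close>)
    then show ?thesis
      by (simp add: exp rand_exp_loss_def ext_expect_def uv_int)
  qed
qed

text \<open>Extended expectations are not linear in general. Here the bound on the loss under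
  \<open>R\<close> makes all positive parts finite, and the finite entropies of \<open>P\<close> and
  \<open>Q\<close> bound their negative parts, so everything is a computation with reals.\<close>

lemma rand_exp_loss_mixture:
  assumes game: "basic_game X A L"
    and P: "P \<in> game_dists X A L" and Q: "Q \<in> game_dists X A L" and R: "R \<in> game_dists X A L"
    and \<zeta>: "\<zeta> \<in> rand_acts X A L"
    and fin: "\<bar>gen_entropy A L P\<bar> \<noteq> \<infinity>" "\<bar>gen_entropy A L Q\<bar> \<noteq> \<infinity>"
    and t: "0 < t" "t < 1"
    and mix: "\<And>B. B \<in> sets P \<Longrightarrow> measure R B = (1 - t) * measure P B + t * measure Q B"
    and R_fin: "rand_exp_loss L R \<zeta> < \<infinity>"
  obtains a b where "rand_exp_loss L P \<zeta> = ereal a" "rand_exp_loss L Q \<zeta> = ereal b"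
    "rand_exp_loss L R \<zeta> = ereal ((1 - t) * a + t * b)"
proof -
  have dist: "P \<in> distributions X" "Q \<in> distributions X" "R \<in> distributions X" "\<zeta> \<in> distributions A"
    using P Q R \<zeta> by (auto simp: game_dists_def rand_acts_def)
  then have prob: "prob_space P" "prob_space Q" "prob_space R" "prob_space \<zeta>"
    and sets: "sets Q = sets P" "sets R = sets P"
    by (auto simp: distributions_def)
  define p where "p M = pos_part_int (M \<Otimes>\<^sub>M \<zeta>) (\<lambda>(x, a). L x a)" for M
  define n where "n M = pos_part_int (M \<Otimes>\<^sub>M \<zeta>) (\<lambda>z. - (case z of (x, a) \<Rightarrow> L x a))" for M
  have loss: "rand_exp_loss L M \<zeta> = enn2ereal (p M) - enn2ereal (n M)" for M
    by (simp add: rand_exp_loss_def ext_expect_def p_def n_def)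
  have defd: "\<not> (p M = \<infinity> \<and> n M = \<infinity>)" if "M \<in> game_dists X A L" for M
    using \<zeta> that by (auto simp: rand_acts_def ext_expect_defined_def p_def n_def)
  have mixture: "pos_part_int (R \<Otimes>\<^sub>M \<zeta>) f =
      ennreal (1 - t) * pos_part_int (P \<Otimes>\<^sub>M \<zeta>) f + ennreal t * pos_part_int (Q \<Otimes>\<^sub>M \<zeta>) f"
    if f: "\<And>M. M \<in> distributions X \<Longrightarrow> f \<in> borel_measurable (M \<Otimes>\<^sub>M \<zeta>)" for f
    using dist prob t sets mix
    by (simp add: pos_part_int_pair(1)[OF _ _ f] nn_integral_mixture[of P Q R] pos_part_int_pair(3)[OF _ _ f])
  have pR: "p R = ennreal (1 - t) * p P + ennreal t * p Q"
    unfolding p_def by (rule mixture) (rule loss_measurable[OF game _ dist(4)])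
  have nR: "n R = ennreal (1 - t) * n P + ennreal t * n Q"
    unfolding n_def by (rule mixture) (rule loss_measurable[OF game _ dist(4)])
  \<comment> \<open>If \<open>p R\<close> were infinite, \<open>n R\<close> would be finite by
    definedness and the loss under \<open>R\<close> infinite.\<close>
  have "p R \<noteq> \<infinity>"
    using R_fin defd[OF R] unfolding loss by (cases "n R") (auto simp: enn2ereal_ennreal)
  \<comment> \<open>Both weights are strictly positive, so an infinite summand would survive in
    \<open>p R\<close>.\<close>
  then have p_fin: "p P \<noteq> \<infinity>" "p Q \<noteq> \<infinity>"
    using t unfolding pR by (auto simp: ennreal_mult_eq_top_iff ennreal_eq_0_iff ennreal_mult_top)
  have n_fin: "n M \<noteq> \<infinity>" if "M \<in> game_dists X A L" "\<bar>gen_entropy A L M\<bar> \<noteq> \<infinity>" "p M \<noteq> \<infinity>" for M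
    using entropy_le_rand_exp_loss[OF game that(1) \<zeta> that(2)] that(2,3) unfolding loss
    by (cases "p M") (auto simp: enn2ereal_ennreal)
  obtain p1 p2 n1 n2 where *: "p P = ennreal p1" "0 \<le> p1" "p Q = ennreal p2" "0 \<le> p2"
    "n P = ennreal n1" "0 \<le> n1" "n Q = ennreal n2" "0 \<le> n2"
    using p_fin n_fin[OF P fin(1)] n_fin[OF Q fin(2)]
    by (cases "p P"; cases "p Q"; cases "n P"; cases "n Q") auto
  have pn_R: "p R = ennreal ((1 - t) * p1 + t * p2)" "n R = ennreal ((1 - t) * n1 + t * n2)"
    unfolding pR nR using * t by (simp_all add: ennreal_mult ennreal_plus)
  have "rand_exp_loss L R \<zeta> = ereal ((1 - t) * p1 + t * p2) - ereal ((1 - t) * n1 + t * n2)"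
    unfolding loss pn_R using * t by (simp only: enn2ereal_ennreal add_nonneg_nonneg
        mult_nonneg_nonneg diff_ge_0_iff_ge less_imp_le)
  also have "\<dots> = ereal ((1 - t) * (p1 - n1) + t * (p2 - n2))"
    by (simp add: algebra_simps)
  finally have "rand_exp_loss L R \<zeta> = ereal ((1 - t) * (p1 - n1) + t * (p2 - n2))" .
  then show ?thesis
    using * by (intro that[of "p1 - n1" "p2 - n2"]) (simp_all add: loss enn2ereal_ennreal)
qed

section \<open>The minimax theorem\<close>

lemma sup_entropy_le_sup_loss:
  assumes game: "basic_game X A L" and sub: "\<Gamma> \<subseteq> game_dists X A L"
    and fin: "\<And>P. P \<in> \<Gamma> \<Longrightarrow> \<bar>gen_entropy A L P\<bar> \<noteq> \<infinity>" and \<zeta>: "\<zeta> \<in> rand_acts X A L"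
  shows "max_entropy A L \<Gamma> \<le> (SUP P\<in>\<Gamma>. rand_exp_loss L P \<zeta>)"
  unfolding max_entropy_def
  using sub by (intro SUP_mono) (auto intro!: bexI entropy_le_rand_exp_loss[OF game _ \<zeta> fin])

text \<open>Point masses give one inequality and averaging the other. This identifies
  \<open>lower_value\<close>, an infimum over randomized acts, with the entropy, an infimum over
  pure acts.\<close>

lemma INF_rand_exp_loss:
  assumes game: "basic_game X A L" and P: "P \<in> game_dists X A L"
    and fin: "\<bar>gen_entropy A L P\<bar> \<noteq> \<infinity>"
  shows "(INF \<zeta>\<in>rand_acts X A L. rand_exp_loss L P \<zeta>) = gen_entropy A L P"
proof (rule antisym)
  have "P \<in> distributions X"
    using P by (simp add: game_dists_def)
  then show "(INF \<zeta>\<in>rand_acts X A L. rand_exp_loss L P \<zeta>) \<le> gen_entropy A L P"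
    unfolding gen_entropy_def
    using pure_act(1,2)[OF game] by (intro INF_mono) (metis order_refl)
  show "gen_entropy A L P \<le> (INF \<zeta>\<in>rand_acts X A L. rand_exp_loss L P \<zeta>)"
    by (intro INF_greatest entropy_le_rand_exp_loss[OF game P _ fin])
qed

text \<open>Everything claimed about the game follows from one act whose loss never exceeds
  \<open>H\<^sup>*\<close>; the opposite inequalities are weak duality. Nonemptiness of \<Gamma>
  keeps the value above \<open>-\<infinity>\<close>.\<close>

lemma minimax_from_act:
  assumes game: "basic_game X A L" and sub: "\<Gamma> \<subseteq> game_dists X A L" and nonempty: "\<Gamma> \<noteq> {}"
    and fin: "\<And>P. P \<in> \<Gamma> \<Longrightarrow> \<bar>gen_entropy A L P\<bar> \<noteq> \<infinity>" and bounded: "max_entropy A L \<Gamma> < \<infinity>"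
    and \<zeta>: "\<zeta>s \<in> rand_acts X A L"
    and le: "\<And>P. P \<in> \<Gamma> \<Longrightarrow> rand_exp_loss L P \<zeta>s \<le> max_entropy A L \<Gamma>"
  shows "(SUP P\<in>\<Gamma>. rand_exp_loss L P \<zeta>s) = max_entropy A L \<Gamma>"
    and "upper_value X A L \<Gamma> = max_entropy A L \<Gamma>"
    and "game_has_value X A L \<Gamma> (max_entropy A L \<Gamma>)"
proof -
  have "(SUP P\<in>\<Gamma>. rand_exp_loss L P \<zeta>s) \<le> max_entropy A L \<Gamma>"
    by (intro SUP_least le)
  then show sup: "(SUP P\<in>\<Gamma>. rand_exp_loss L P \<zeta>s) = max_entropy A L \<Gamma>"
    by (intro antisym sup_entropy_le_sup_loss[OF game sub fin \<zeta>])
  show upper: "upper_value X A L \<Gamma> = max_entropy A L \<Gamma>"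
    unfolding upper_value_def
  proof (rule antisym)
    show "(INF \<zeta>\<in>rand_acts X A L. SUP P\<in>\<Gamma>. rand_exp_loss L P \<zeta>) \<le> max_entropy A L \<Gamma>"
      using INF_lower[OF \<zeta>, of "\<lambda>\<zeta>. SUP P\<in>\<Gamma>. rand_exp_loss L P \<zeta>"] sup by simp
    show "max_entropy A L \<Gamma> \<le> (INF \<zeta>\<in>rand_acts X A L. SUP P\<in>\<Gamma>. rand_exp_loss L P \<zeta>)"
      by (intro INF_greatest sup_entropy_le_sup_loss[OF game sub fin])
  qed
  have "lower_value X A L \<Gamma> = max_entropy A L \<Gamma>"
    unfolding lower_value_def max_entropy_def
    using sub by (intro SUP_cong refl INF_rand_exp_loss[OF game _ fin]) auto
  moreover have "\<bar>max_entropy A L \<Gamma>\<bar> \<noteq> \<infinity>"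
  proof -
    obtain P where P: "P \<in> \<Gamma>"
      using nonempty by blast
    then have "gen_entropy A L P \<le> max_entropy A L \<Gamma>"
      unfolding max_entropy_def by (rule SUP_upper)
    then show ?thesis
      using fin[OF P] bounded by auto
  qed
  ultimately show "game_has_value X A L \<Gamma> (max_entropy A L \<Gamma>)"
    by (simp add: game_has_value_def upper)
qed

text \<open>The integral of a test function is affine in the mixing weight, and the share of
  \<open>P\<close> vanishes with \<open>t n\<close>. Thus a limit \<open>Q0\<close> found before
  \<open>P\<close> is named serves every \<open>P\<close>.\<close>

lemma converges_weakly_perturbation:
  fixes Q R :: "nat \<Rightarrow> 'x::metric_space measure"
  assumes Q: "\<And>n. Q n \<in> distributions borel" and P: "P \<in> distributions borel"
    and R: "\<And>n. R n \<in> distributions borel"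
    and t: "\<And>n. 0 \<le> t n" "\<And>n. t n \<le> 1" "t \<longlonglongrightarrow> 0"
    and mix: "\<And>n B. B \<in> sets (Q n) \<Longrightarrow> measure (R n) B = (1 - t n) * measure (Q n) B + t n * measure P B"
    and conv: "converges_weakly Q Q0"
  shows "converges_weakly R Q0"
  unfolding converges_weakly_def
proof (intro allI impI)
  fix f :: "'x \<Rightarrow> real"
  assume f: "continuous_on UNIV f \<and> bounded (range f)"
  then obtain b where b: "\<And>x. \<bar>f x\<bar> \<le> b"
    unfolding bounded_pos by auto
  have dist: "prob_space (Q n)" "prob_space (R n)" "prob_space P"
    "sets (Q n) = sets borel" "sets (R n) = sets (Q n)" "sets P = sets (Q n)" for n
    using Q[of n] R[of n] P by (auto simp: distributions_def)
  have "integral\<^sup>L (R n) f = (1 - t n) * integral\<^sup>L (Q n) f + t n * integral\<^sup>L P f" for n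
  proof (rule integral_mixture[OF dist(1,3,2,6,5) t(1,2) mix _ b])
    show "f \<in> borel_measurable (Q n)"
      using f borel_measurable_continuous_onI by (auto simp: dist(4) cong: measurable_cong_sets)
  qed
  moreover have "(\<lambda>n. (1 - t n) * integral\<^sup>L (Q n) f + t n * integral\<^sup>L P f)
      \<longlonglongrightarrow> (1 - 0) * integral\<^sup>L Q0 f + 0 * integral\<^sup>L P f"
    using conv f unfolding converges_weakly_def by (intro tendsto_intros t(3)) auto
  ultimately show "(\<lambda>n. integral\<^sup>L (R n) f) \<longlonglongrightarrow> integral\<^sup>L Q0 f"
    by simp
qed

text \<open>\<open>\<zeta>0\<close> is fixed before \<open>P\<close>, while the sequence fed to
  \<open>limits\<close> depends on \<open>P\<close>: it consists of mixtures with a little of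
  \<open>P\<close>. The excess of \<open>L(P, \<zeta> n)\<close> over \<open>h\<close> appears
  multiplied by \<open>t n\<close>, so after division the entropy defect must still vanish. This is
  why \<open>near\<close> allows only the square of \<open>t n\<close>.\<close>

lemma bayes_limit_le_sup_entropy:
  fixes A :: "'a measure" and L :: "'x::metric_space \<Rightarrow> 'a \<Rightarrow> ereal" and \<Gamma> :: "'x measure set"
  assumes game: "basic_game borel A L" and sub: "\<Gamma> \<subseteq> game_dists borel A L"
    and convex: "convex_dists \<Gamma>"
    and bayes: "\<And>P. P \<in> \<Gamma> \<Longrightarrow> \<exists>\<zeta>. bayes_act borel A L P \<zeta>"
    and fin: "\<And>P. P \<in> \<Gamma> \<Longrightarrow> \<bar>gen_entropy A L P\<bar> \<noteq> \<infinity>"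
    and h: "max_entropy A L \<Gamma> = ereal h"
    and limits: "\<And>Q. (\<And>n. Q n \<in> \<Gamma>) \<Longrightarrow> (\<exists>b::real. \<forall>n. ereal b \<le> gen_entropy A L (Q n)) \<Longrightarrow>
      converges_weakly Q Q0 \<Longrightarrow>
      \<exists>\<zeta>. (\<forall>n. bayes_act borel A L (Q n) (\<zeta> n)) \<and>
        (\<forall>P\<in>\<Gamma>. rand_exp_loss L P \<zeta>0 \<le> liminf (\<lambda>n. rand_exp_loss L P (\<zeta> n)))"
    and Q: "\<And>n. Q n \<in> \<Gamma>" and conv: "converges_weakly Q Q0"
    and near: "\<And>n. ereal (h - 1 / (real n + 2)\<^sup>2) \<le> gen_entropy A L (Q n)"
    and P: "P \<in> \<Gamma>"
  shows "rand_exp_loss L P \<zeta>0 \<le> ereal h"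
proof -
  \<comment> \<open>The shift by 2 keeps the weight strictly between 0 and 1 already at
    \<open>n = 0\<close>, as the mixture lemma requires.\<close>
  define t :: "nat \<Rightarrow> real" where "t n = 1 / (real n + 2)" for n
  have t: "0 < t n" "t n < 1" for n
    by (auto simp: t_def)
  have t_lim: "t \<longlonglongrightarrow> 0"
    unfolding t_def by real_asymp
  have dist: "M \<in> distributions borel" if "M \<in> \<Gamma>" for M
    using sub that by (auto simp: game_dists_def)
  have le_h: "gen_entropy A L M \<le> ereal h" if "M \<in> \<Gamma>" for M
    using SUP_upper[OF that, of "gen_entropy A L"] h by (simp add: max_entropy_def)
  obtain k where k: "gen_entropy A L P = ereal k"
    using fin[OF P] by (cases "gen_entropy A L P") auto
  have "\<exists>R\<in>\<Gamma>. \<forall>B\<in>sets (Q n). measure R B = (1 - t n) * measure (Q n) B + t n * measure P B" for n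
    using convex Q P t[of n] unfolding convex_dists_def by (simp add: less_imp_le)
  then obtain R where R: "\<And>n. R n \<in> \<Gamma>"
    and mix: "\<And>n B. B \<in> sets (Q n) \<Longrightarrow> measure (R n) B = (1 - t n) * measure (Q n) B + t n * measure P B"
    by metis
  have conv_R: "converges_weakly R Q0"
    using t t_lim by (intro converges_weakly_perturbation[OF _ _ _ _ _ _ mix conv])
      (auto simp: dist Q P R less_imp_le)
  \<comment> \<open>The Bayes act of the mixture is judged under both components:
    \<open>near\<close> bounds \<open>a\<close> from below, and the entropy \<open>k\<close> of
    \<open>P\<close> bounds \<open>b\<close>.\<close>
  have split: "\<exists>a b. rand_exp_loss L (Q n) \<zeta> = ereal a \<and> rand_exp_loss L P \<zeta> = ereal b \<and>
      h - (t n)\<^sup>2 \<le> a \<and> k \<le> b \<and> ereal ((1 - t n) * a + t n * b) \<le> gen_entropy A L (R n)"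
    if \<zeta>: "bayes_act borel A L (R n) \<zeta>" for n \<zeta>
  proof -
    have R_le: "rand_exp_loss L (R n) \<zeta> \<le> gen_entropy A L (R n)"
      using sub R by (intro bayes_act_le_entropy[OF game _ \<zeta> fin]) auto
    then have R_fin: "rand_exp_loss L (R n) \<zeta> < \<infinity>"
      using fin[OF R[of n]] by (cases "gen_entropy A L (R n)") auto
    have \<zeta>': "\<zeta> \<in> rand_acts borel A L"
      using \<zeta> by (simp add: bayes_act_def)
    obtain a b where ab: "rand_exp_loss L (Q n) \<zeta> = ereal a" "rand_exp_loss L P \<zeta> = ereal b"
      "rand_exp_loss L (R n) \<zeta> = ereal ((1 - t n) * a + t n * b)"
      using rand_exp_loss_mixture[OF game subsetD[OF sub Q] subsetD[OF sub P] subsetD[OF sub R] \<zeta>'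
          fin[OF Q] fin[OF P] t mix R_fin] by blast
    have "ereal (h - (t n)\<^sup>2) \<le> ereal a"
      using order_trans[OF near[of n] entropy_le_rand_exp_loss[OF game subsetD[OF sub Q] \<zeta>' fin[OF Q]]] ab(1)
      by (simp add: t_def power_divide)
    moreover have "ereal k \<le> ereal b"
      using entropy_le_rand_exp_loss[OF game subsetD[OF sub P] \<zeta>' fin[OF P]] ab k by simp
    ultimately show ?thesis
      using ab R_le by auto
  qed
  \<comment> \<open>\<open>limits\<close> demands entropies bounded below along the mixtures. Since
    \<open>a\<close> and \<open>b\<close> are both at least the minimum of \<open>h - 1\<close> and
    \<open>k\<close>, so is their convex combination.\<close>
  have below: "ereal (min (h - 1) k) \<le> gen_entropy A L (R n)" for n
  proof -
    obtain \<zeta> where "bayes_act borel A L (R n) \<zeta>"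
      using bayes R by blast
    from split[OF this] obtain a b where ab: "h - (t n)\<^sup>2 \<le> a" "k \<le> b"
      "ereal ((1 - t n) * a + t n * b) \<le> gen_entropy A L (R n)"
      by blast
    have "(t n)\<^sup>2 \<le> 1"
      using t[of n] by (simp add: power_le_one)
    then have "min (h - 1) k \<le> a" "min (h - 1) k \<le> b"
      using ab by auto
    then have "(1 - t n) * min (h - 1) k + t n * min (h - 1) k \<le> (1 - t n) * a + t n * b"
      using t[of n] by (intro add_mono mult_left_mono) auto
    then have "ereal (min (h - 1) k) \<le> ereal ((1 - t n) * a + t n * b)"
      unfolding ereal_less_eq by (simp add: algebra_simps)
    then show ?thesis
      using ab(3) by (rule order_trans)
  qed
  from below have "\<exists>b::real. \<forall>n. ereal b \<le> gen_entropy A L (R n)"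
    by blast
  from limits[OF R this conv_R] obtain \<zeta> where \<zeta>: "\<And>n. bayes_act borel A L (R n) (\<zeta> n)"
    and lim: "rand_exp_loss L P \<zeta>0 \<le> liminf (\<lambda>n. rand_exp_loss L P (\<zeta> n))"
    using P by auto
  have "rand_exp_loss L P (\<zeta> n) \<le> ereal (h + t n)" for n
  proof -
    obtain a b where ab: "rand_exp_loss L P (\<zeta> n) = ereal b" "h - (t n)\<^sup>2 \<le> a"
      "ereal ((1 - t n) * a + t n * b) \<le> gen_entropy A L (R n)"
      using split[OF \<zeta>] by blast
    have "(1 - t n) * a + t n * b \<le> h"
      using order_trans[OF ab(3) le_h[OF R]] by simp
    moreover have "(1 - t n) * (h - (t n)\<^sup>2) \<le> (1 - t n) * a"
      using t[of n] ab(2) by (intro mult_left_mono) auto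
    \<comment> \<open>The cube is the last term of
      \<open>(1 - t)(h - t^2) = h - t h - t^2 + t^3\<close>; dropping it leaves
      \<open>t b \<le> t (h + t)\<close>.\<close>
    moreover have "0 \<le> t n ^ 3"
      using t[of n] by simp
    ultimately have "t n * b \<le> t n * (h + t n)"
      by (simp add: algebra_simps power2_eq_square power3_eq_cube)
    then show ?thesis
      using t[of n] ab(1) by simp
  qed
  then have "liminf (\<lambda>n. rand_exp_loss L P (\<zeta> n)) \<le> liminf (\<lambda>n. ereal (h + t n))"
    by (intro Liminf_mono always_eventually allI)
  also have "(\<lambda>n. ereal (h + t n)) \<longlonglongrightarrow> ereal (h + 0)"
    by (intro tendsto_intros t_lim)
  then have "liminf (\<lambda>n. ereal (h + t n)) = ereal h"
    by (simp add: lim_imp_Liminf)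
  finally show ?thesis
    using lim by simp
qed

theorem theorem6p4:
  fixes A :: "'a measure"
    and L :: "'x::metric_space \<Rightarrow> 'a \<Rightarrow> ereal"
    and \<Gamma> :: "'x measure set"
  assumes game: "basic_game borel A L"
    and sub: "\<Gamma> \<subseteq> game_dists borel A L"
    and nonempty: "\<Gamma> \<noteq> {}"
    and limits: "bayes_limit_condition borel A L \<Gamma>"
    and convex: "convex_dists \<Gamma>"
    and bayes: "\<And>P. P \<in> \<Gamma> \<Longrightarrow> \<exists>\<zeta>P. bayes_act borel A L P \<zeta>P"
    and finite_entropy: "\<And>P. P \<in> \<Gamma> \<Longrightarrow> \<bar>gen_entropy A L P\<bar> \<noteq> \<infinity>"
    and bounded_entropy: "max_entropy A L \<Gamma> < \<infinity>"
    and tight: "tight_dists \<Gamma>"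
  shows "\<exists>\<zeta>s\<in>rand_acts borel A L.
    (SUP P\<in>\<Gamma>. rand_exp_loss L P \<zeta>s) =
      (INF \<zeta>\<in>rand_acts borel A L. SUP P\<in>\<Gamma>. rand_exp_loss L P \<zeta>) \<and>
    (INF \<zeta>\<in>rand_acts borel A L. SUP P\<in>\<Gamma>. rand_exp_loss L P \<zeta>) =
      (SUP P\<in>\<Gamma>. INF a\<in>space A. exp_loss L P a) \<and>
    (SUP P\<in>\<Gamma>. INF a\<in>space A. exp_loss L P a) = max_entropy A L \<Gamma> \<and>
    game_has_value borel A L \<Gamma> (max_entropy A L \<Gamma>) \<and>
    robust_bayes borel A L \<Gamma> \<zeta>s"
proof -
  obtain h where h: "max_entropy A L \<Gamma> = ereal h"
  proof -
    obtain P where P: "P \<in> \<Gamma>"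
      using nonempty by blast
    then have "gen_entropy A L P \<le> max_entropy A L \<Gamma>"
      unfolding max_entropy_def by (rule SUP_upper)
    then show ?thesis
      using finite_entropy[OF P] bounded_entropy that by (cases "max_entropy A L \<Gamma>") auto
  qed
  have "\<exists>Q\<in>\<Gamma>. ereal (h - 1 / (real n + 2)\<^sup>2) < gen_entropy A L Q" for n
  proof -
    have "ereal (h - 1 / (real n + 2)\<^sup>2) < (SUP Q\<in>\<Gamma>. gen_entropy A L Q)"
      using h by (simp add: max_entropy_def)
    then show ?thesis
      by (simp add: less_SUP_iff)
  qed
  then obtain Q where Q: "\<And>n. Q n \<in> \<Gamma>"
    and near: "\<And>n. ereal (h - 1 / (real n + 2)\<^sup>2) < gen_entropy A L (Q n)"
    by metis
  have dist: "Q n \<in> distributions borel" for n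
    using Q sub by (auto simp: game_dists_def)
  have "tight_dists (range Q)"
    unfolding tight_dists_def
  proof (intro allI impI)
    fix \<epsilon> :: real assume "0 < \<epsilon>"
    then obtain C where "compact C" "\<forall>P\<in>\<Gamma>. measure P C > 1 - \<epsilon>"
      using tight unfolding tight_dists_def by auto
    then show "\<exists>C. compact C \<and> (\<forall>P\<in>range Q. measure P C > 1 - \<epsilon>)"
      using Q by (intro exI[of _ C]) auto
  qed
  then obtain r Q0 where r: "strict_mono r" and Q0: "Q0 \<in> distributions borel"
    and conv: "converges_weakly (Q \<circ> r) Q0"
    by (rule tight_imp_weakly_convergent_subsequence[OF dist])
  \<comment> \<open>Passing to the subsequence only improves the bound, because
    \<open>n \<le> r n\<close>.\<close>
  have near_r: "ereal (h - 1 / (real n + 2)\<^sup>2) \<le> gen_entropy A L ((Q \<circ> r) n)" for n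
  proof -
    have "1 / (real (r n) + 2)\<^sup>2 \<le> 1 / (real n + 2)\<^sup>2"
      using seq_suble[OF r, of n] by (intro divide_left_mono power_mono) auto
    then have "ereal (h - 1 / (real n + 2)\<^sup>2) \<le> ereal (h - 1 / (real (r n) + 2)\<^sup>2)"
      by simp
    also have "\<dots> \<le> gen_entropy A L (Q (r n))"
      by (rule less_imp_le[OF near])
    finally show ?thesis
      by simp
  qed
  \<comment> \<open>The act is \<open>\<beta> Q0\<close>, extracted before any sequence
    \<open>S\<close> is considered, so the mixtures belonging to different \<open>P\<close> all lead
    to the same act.\<close>
  obtain \<zeta>0 where \<zeta>0: "\<And>S. (\<And>n. S n \<in> \<Gamma>) \<Longrightarrow>
      (\<exists>b::real. \<forall>n. ereal b \<le> gen_entropy A L (S n)) \<Longrightarrow> converges_weakly S Q0 \<Longrightarrow>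
      bayes_act borel A L Q0 \<zeta>0 \<and>
      (\<exists>\<zeta>. (\<forall>n. bayes_act borel A L (S n) (\<zeta> n)) \<and>
        (\<forall>P\<in>\<Gamma>. rand_exp_loss L P \<zeta>0 \<le> liminf (\<lambda>n. rand_exp_loss L P (\<zeta> n))))"
    using limits unfolding bayes_limit_condition_def
  proof (elim exE, goal_cases)
    case (1 \<beta>)
    show ?case
    proof (rule 1(1)[of "\<beta> Q0"])
      fix S
      assume S: "\<And>n. S n \<in> \<Gamma>" "\<exists>b::real. \<forall>n. ereal b \<le> gen_entropy A L (S n)"
        "converges_weakly S Q0"
      have "\<forall>n. S n \<in> \<Gamma> \<and> (\<exists>\<zeta>. bayes_act borel A L (S n) \<zeta>)"
        using S(1) bayes by blast
      then show "bayes_act borel A L Q0 (\<beta> Q0) \<and>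
          (\<exists>\<zeta>. (\<forall>n. bayes_act borel A L (S n) (\<zeta> n)) \<and>
            (\<forall>P\<in>\<Gamma>. rand_exp_loss L P (\<beta> Q0) \<le> liminf (\<lambda>n. rand_exp_loss L P (\<zeta> n))))"
        using 1(2)[THEN spec[of _ S], THEN spec[of _ Q0]] S(2,3) Q0 by simp
    qed
  qed
  have "\<exists>b::real. \<forall>n. ereal b \<le> gen_entropy A L ((Q \<circ> r) n)"
  proof (intro exI allI)
    fix n
    have "1 \<le> (real n + 2)\<^sup>2"
      by (rule one_le_power) simp
    then have "1 / (real n + 2)\<^sup>2 \<le> 1"
      by (simp add: divide_le_eq)
    then have "ereal (h - 1) \<le> ereal (h - 1 / (real n + 2)\<^sup>2)"
      by simp
    then show "ereal (h - 1) \<le> gen_entropy A L ((Q \<circ> r) n)"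
      using near_r by (rule order_trans)
  qed
  \<comment> \<open>The unperturbed sequence is used here to learn that \<open>\<zeta>0\<close> is a
    Bayes act, hence a member of \<open>rand_acts\<close>.\<close>
  then have "bayes_act borel A L Q0 (\<zeta>0)"
    using \<zeta>0[of "Q \<circ> r"] Q conv by simp
  then have act: "\<zeta>0 \<in> rand_acts borel A L"
    by (simp add: bayes_act_def)
  have "rand_exp_loss L P (\<zeta>0) \<le> max_entropy A L \<Gamma>" if "P \<in> \<Gamma>" for P
    unfolding h
    by (rule bayes_limit_le_sup_entropy[OF game sub convex bayes finite_entropy h _ _ conv near_r that])
      (use \<zeta>0 Q in auto)
  from minimax_from_act[OF game sub nonempty finite_entropy bounded_entropy act this] act show ?thesis
    by (intro bexI[of _ "\<zeta>0"])
      (auto simp: robust_bayes_def upper_value_def max_entropy_def gen_entropy_def)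
qed

end
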